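(* Let $R$ be a noetherian commutative ring and $X=\operatorname{Spec}R$. Then $\mathrm H^i(X,1+\mathcal N)=0$ for all $i\geq1$.
   Context: $\mathcal N$ is the sheaf of nilpotents on $X$, i.e. the sheaf of ideals $\mathcal N(U)=\operatorname{nil}(\mathcal O_X(U))$ (the nilradical of $\mathcal O_X(U)$). $1+\mathcal N$ is the sheaf of unipotent units, the sheaf of abelian groups (under multiplication) given by $(1+\mathcal N)(U)=1+\operatorname{nil}(\mathcal O_X(U))\subseteq\mathcal O_X^*(U)$. $\mathrm H^i$ is sheaf cohomology in the Zariski topology. *)

theory Defs
  imports "HOL-Analysis.Abstract_Topology" "HOL-Algebra.Elementary_Groups" "HOL-Algebra.Ring_Divisibility"
begin

section \<open>Sheaves of abelian groups on a topological space\<close>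

text \<open>Abelian groups are written multiplicatively, as in \<^locale>\<open>comm_group\<close>. A presheaf has data for
  every set; only the values on open sets matter.\<close>

record ('x, 'b) presheaf =
  sections :: "'x set \<Rightarrow> 'b monoid"
  restr :: "'x set \<Rightarrow> 'x set \<Rightarrow> 'b \<Rightarrow> 'b" \<comment> \<open>\<open>restr F U V\<close> goes from \<open>F(U)\<close> to \<open>F(V)\<close>, for \<open>V \<subseteq> U\<close>\<close>

locale ab_presheaf =
  fixes X :: "'x topology" and F :: "('x, 'b) presheaf"
  assumes comm_group_sections: "openin X U \<Longrightarrow> comm_group (sections F U)"
    and restr_hom: "\<lbrakk>openin X U; openin X V; V \<subseteq> U\<rbrakk> \<Longrightarrow> restr F U V \<in> hom (sections F U) (sections F V)"
    and restr_id: "\<lbrakk>openin X U; s \<in> carrier (sections F U)\<rbrakk> \<Longrightarrow> restr F U U s = s"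
    and restr_comp: "\<lbrakk>openin X U; openin X V; openin X W; W \<subseteq> V; V \<subseteq> U; s \<in> carrier (sections F U)\<rbrakk>
      \<Longrightarrow> restr F V W (restr F U V s) = restr F U W s"

locale ab_sheaf = ab_presheaf +
  assumes locality: "\<lbrakk>\<And>V. V \<in> \<U> \<Longrightarrow> openin X V;
      s \<in> carrier (sections F (\<Union>\<U>)); t \<in> carrier (sections F (\<Union>\<U>));
      \<And>V. V \<in> \<U> \<Longrightarrow> restr F (\<Union>\<U>) V s = restr F (\<Union>\<U>) V t\<rbrakk> \<Longrightarrow> s = t"
    and gluing: "\<lbrakk>\<And>V. V \<in> \<U> \<Longrightarrow> openin X V;
      \<And>V. V \<in> \<U> \<Longrightarrow> \<sigma> V \<in> carrier (sections F V);
      \<And>V W. \<lbrakk>V \<in> \<U>; W \<in> \<U>\<rbrakk> \<Longrightarrow> restr F V (V \<inter> W) (\<sigma> V) = restr F W (V \<inter> W) (\<sigma> W)\<rbrakk>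
      \<Longrightarrow> \<exists>s \<in> carrier (sections F (\<Union>\<U>)). \<forall>V \<in> \<U>. restr F (\<Union>\<U>) V s = \<sigma> V"

definition presheaf_hom ::
  "'x topology \<Rightarrow> ('x, 'b) presheaf \<Rightarrow> ('x, 'c) presheaf \<Rightarrow> ('x set \<Rightarrow> 'b \<Rightarrow> 'c) \<Rightarrow> bool" where
  "presheaf_hom X F G \<phi> \<longleftrightarrow>
    (\<forall>U. openin X U \<longrightarrow> \<phi> U \<in> hom (sections F U) (sections G U)) \<and>
    (\<forall>U V. openin X U \<longrightarrow> openin X V \<longrightarrow> V \<subseteq> U \<longrightarrow>
      (\<forall>s \<in> carrier (sections F U). \<phi> V (restr F U V s) = restr G U V (\<phi> U s)))"

text \<open>For sheaves, the monomorphisms are the homomorphisms that are injective on sections.\<close>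

definition presheaf_mono ::
  "'x topology \<Rightarrow> ('x, 'b) presheaf \<Rightarrow> ('x, 'c) presheaf \<Rightarrow> ('x set \<Rightarrow> 'b \<Rightarrow> 'c) \<Rightarrow> bool" where
  "presheaf_mono X F G \<phi> \<longleftrightarrow> presheaf_hom X F G \<phi> \<and>
    (\<forall>U. openin X U \<longrightarrow> inj_on (\<phi> U) (carrier (sections F U)))"

text \<open>Exactness of \<open>F \<rightarrow> G \<rightarrow> H\<close> at \<open>G\<close> as sheaves: the kernel of \<open>\<psi>\<close> is the image sheaf of \<open>\<phi>\<close>, that is,
  the sections of \<open>G\<close> that are locally in the image of \<open>\<phi>\<close>.\<close>

definition sheaf_exact ::
  "'x topology \<Rightarrow> ('x, 'b) presheaf \<Rightarrow> ('x, 'c) presheaf \<Rightarrow> ('x, 'd) presheaf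
    \<Rightarrow> ('x set \<Rightarrow> 'b \<Rightarrow> 'c) \<Rightarrow> ('x set \<Rightarrow> 'c \<Rightarrow> 'd) \<Rightarrow> bool" where
  "sheaf_exact X F G H \<phi> \<psi> \<longleftrightarrow>
    (\<forall>U s. openin X U \<longrightarrow> s \<in> carrier (sections G U) \<longrightarrow>
      (\<psi> U s = \<one>\<^bsub>sections H U\<^esub> \<longleftrightarrow>
        (\<forall>x \<in> U. \<exists>V. openin X V \<and> x \<in> V \<and> V \<subseteq> U \<and>
          (\<exists>t \<in> carrier (sections F V). \<phi> V t = restr G U V s))))"

text \<open>Injective objects of the category of sheaves of abelian groups on \<open>X\<close>. A definition cannot quantify
  over types, so the extension property is required for all monomorphisms \<open>A \<rightarrow> B\<close> of sheaves with
  sections in the type \<^typ>\<open>'x \<Rightarrow> int\<close>. This loses nothing. The sheaves \<open>\<int>\<^sub>U\<close> (the constant sheaf on an open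
  \<open>U\<close> extended by zero) form a set of generators, so by Baer's criterion it suffices to
  extend along the inclusions of subsheaves of the \<open>\<int>\<^sub>U\<close>; sections of these are integer-valued functions
  on open sets. The sections of \<open>I\<close> itself may lie in any type \<open>'b\<close>.\<close>

definition injective_sheaf :: "'x topology \<Rightarrow> ('x, 'b) presheaf \<Rightarrow> bool" where
  "injective_sheaf X I \<longleftrightarrow> ab_sheaf X I \<and>
    (\<forall>(A :: ('x, 'x \<Rightarrow> int) presheaf) (B :: ('x, 'x \<Rightarrow> int) presheaf) \<iota> f.
      ab_sheaf X A \<longrightarrow> ab_sheaf X B \<longrightarrow> presheaf_mono X A B \<iota> \<longrightarrow> presheaf_hom X A I f \<longrightarrow>
      (\<exists>g. presheaf_hom X B I g \<and>
        (\<forall>U s. openin X U \<longrightarrow> s \<in> carrier (sections A U) \<longrightarrow> g U (\<iota> U s) = f U s)))"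

text \<open>\<open>0 \<rightarrow> F \<rightarrow> I 0 \<rightarrow> I 1 \<rightarrow> \<dots>\<close>, with augmentation \<open>\<epsilon>\<close> and differentials \<open>d n : I n \<rightarrow> I (n + 1)\<close>.\<close>

definition injective_resolution ::
  "'x topology \<Rightarrow> ('x, 'f) presheaf \<Rightarrow> (nat \<Rightarrow> ('x, 'b) presheaf)
    \<Rightarrow> ('x set \<Rightarrow> 'f \<Rightarrow> 'b) \<Rightarrow> (nat \<Rightarrow> 'x set \<Rightarrow> 'b \<Rightarrow> 'b) \<Rightarrow> bool" where
  "injective_resolution X F I \<epsilon> d \<longleftrightarrow>
    (\<forall>n. injective_sheaf X (I n)) \<and>
    presheaf_mono X F (I 0) \<epsilon> \<and>
    (\<forall>n. presheaf_hom X (I n) (I (Suc n)) (d n)) \<and>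
    sheaf_exact X F (I 0) (I 1) \<epsilon> (d 0) \<and>
    (\<forall>n. sheaf_exact X (I n) (I (Suc n)) (I (Suc (Suc n))) (d n) (d (Suc n)))"

text \<open>The \<open>i\<close>-th cohomology group of the complex of global sections of \<open>(I, d)\<close>. If \<open>(I, d)\<close> is an injective
  resolution of a sheaf \<open>F\<close>, this is the sheaf cohomology \<open>H\<^sup>i(X, F)\<close>, the \<open>i\<close>-th right derived functor of
  global sections; it does not depend on the resolution.\<close>

definition cocycles ::
  "'x topology \<Rightarrow> (nat \<Rightarrow> ('x, 'b) presheaf) \<Rightarrow> (nat \<Rightarrow> 'x set \<Rightarrow> 'b \<Rightarrow> 'b) \<Rightarrow> nat \<Rightarrow> 'b set" where
  "cocycles X I d i =
    kernel (sections (I i) (topspace X)) (sections (I (Suc i)) (topspace X)) (d i (topspace X))"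

definition coboundaries ::
  "'x topology \<Rightarrow> (nat \<Rightarrow> ('x, 'b) presheaf) \<Rightarrow> (nat \<Rightarrow> 'x set \<Rightarrow> 'b \<Rightarrow> 'b) \<Rightarrow> nat \<Rightarrow> 'b set" where
  "coboundaries X I d i =
    (case i of
      0 \<Rightarrow> {\<one>\<^bsub>sections (I 0) (topspace X)\<^esub>}
    | Suc j \<Rightarrow> d j (topspace X) ` carrier (sections (I j) (topspace X)))"

definition cohomology_group ::
  "'x topology \<Rightarrow> (nat \<Rightarrow> ('x, 'b) presheaf) \<Rightarrow> (nat \<Rightarrow> 'x set \<Rightarrow> 'b \<Rightarrow> 'b) \<Rightarrow> nat \<Rightarrow> 'b set monoid" where
  "cohomology_group X I d i =
    (sections (I i) (topspace X)) \<lparr>carrier := cocycles X I d i\<rparr> Mod coboundaries X I d i"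


section \<open>The spectrum of a ring and its structure sheaf\<close>

definition Spec :: "('a, 'm) ring_scheme \<Rightarrow> 'a set set" where
  "Spec R = {P. primeideal P R}"

definition zariski_open :: "('a, 'm) ring_scheme \<Rightarrow> 'a set set \<Rightarrow> bool" where
  "zariski_open R U \<longleftrightarrow> (\<exists>E \<subseteq> carrier R. U = {P \<in> Spec R. \<not> E \<subseteq> P})"

definition zariski :: "('a, 'm) ring_scheme \<Rightarrow> 'a set topology" where
  "zariski R = topology (zariski_open R)"

lemma istopology_zariski: "istopology (zariski_open R)"
  unfolding istopology_def
proof (intro conjI allI impI)
  fix U V assume "zariski_open R U" "zariski_open R V"
  then obtain E F where E: "E \<subseteq> carrier R" "U = {P \<in> Spec R. \<not> E \<subseteq> P}"
    and F: "F \<subseteq> carrier R" "V = {P \<in> Spec R. \<not> F \<subseteq> P}"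
    unfolding zariski_open_def by blast
  let ?EF = "{x \<otimes>\<^bsub>R\<^esub> y | x y. x \<in> E \<and> y \<in> F}"
  have EF: "?EF \<subseteq> P \<longleftrightarrow> E \<subseteq> P \<or> F \<subseteq> P" if P: "P \<in> Spec R" for P
  proof -
    interpret primeideal P R using P by (simp add: Spec_def)
    show ?thesis
      using I_prime I_l_closed I_r_closed E(1) F(1) by (auto simp: subset_iff; metis)
  qed
  have "U \<inter> V = {P \<in> Spec R. \<not> E \<subseteq> P \<and> \<not> F \<subseteq> P}"
    unfolding E(2) F(2) by auto
  also have "\<dots> = {P \<in> Spec R. \<not> ?EF \<subseteq> P}"
    by (intro Collect_cong conj_cong refl) (simp only: EF de_Morgan_disj)
  finally have UV: "U \<inter> V = {P \<in> Spec R. \<not> ?EF \<subseteq> P}" .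
  show "zariski_open R (U \<inter> V)"
  proof (cases "Spec R = {}")
    case True
    then show ?thesis
      unfolding zariski_open_def E(2) by (intro exI[of _ "{}"]) simp
  next
    case False
    then obtain P where "primeideal P R" by (auto simp: Spec_def)
    then interpret primeideal P R .
    have "?EF \<subseteq> carrier R" using E(1) F(1) by auto
    then show ?thesis
      unfolding zariski_open_def UV by blast
  qed
next
  fix \<K> assume "\<forall>K\<in>\<K>. zariski_open R K"
  then obtain E where E: "\<And>K. K \<in> \<K> \<Longrightarrow> E K \<subseteq> carrier R \<and> K = {P \<in> Spec R. \<not> E K \<subseteq> P}"
    unfolding zariski_open_def by metis
  have "\<Union>\<K> = {P \<in> Spec R. \<not> (\<Union>K\<in>\<K>. E K) \<subseteq> P}"
  proof -
    have "x \<in> K \<longleftrightarrow> x \<in> Spec R \<and> \<not> E K \<subseteq> x" if "K \<in> \<K>" for x K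
      using E[OF that] by blast
    then show ?thesis by blast
  qed
  then show "zariski_open R (\<Union>\<K>)"
    unfolding zariski_open_def using E
    by (intro exI[of _ "\<Union>K\<in>\<K>. E K"]) blast
qed

lemma openin_zariski: "openin (zariski R) U \<longleftrightarrow> zariski_open R U"
  by (simp add: zariski_def istopology_zariski)

text \<open>The localization \<open>S\<^sup>-\<^sup>1R\<close> at a multiplicative set \<open>S\<close>; \<open>loc_frac R S r s\<close> is the class of \<open>r/s\<close>.
  In the operations all representatives give the same class, so each union is that class.\<close>

definition loc_rel :: "('a, 'm) ring_scheme \<Rightarrow> 'a set \<Rightarrow> (('a \<times> 'a) \<times> ('a \<times> 'a)) set" where
  "loc_rel R S = {((r, s), (r', s')). r \<in> carrier R \<and> s \<in> S \<and> r' \<in> carrier R \<and> s' \<in> S \<and>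
    (\<exists>t \<in> S. t \<otimes>\<^bsub>R\<^esub> (r \<otimes>\<^bsub>R\<^esub> s') = t \<otimes>\<^bsub>R\<^esub> (r' \<otimes>\<^bsub>R\<^esub> s))}"

definition loc_frac :: "('a, 'm) ring_scheme \<Rightarrow> 'a set \<Rightarrow> 'a \<Rightarrow> 'a \<Rightarrow> ('a \<times> 'a) set" where
  "loc_frac R S r s = loc_rel R S `` {(r, s)}"

definition localization :: "('a, 'm) ring_scheme \<Rightarrow> 'a set \<Rightarrow> ('a \<times> 'a) set ring" where
  "localization R S =
    \<lparr>carrier = (carrier R \<times> S) // loc_rel R S,
     mult = (\<lambda>A B. \<Union>(r, s) \<in> A. \<Union>(r', s') \<in> B. loc_frac R S (r \<otimes>\<^bsub>R\<^esub> r') (s \<otimes>\<^bsub>R\<^esub> s')),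
     one = loc_frac R S \<one>\<^bsub>R\<^esub> \<one>\<^bsub>R\<^esub>,
     zero = loc_frac R S \<zero>\<^bsub>R\<^esub> \<one>\<^bsub>R\<^esub>,
     add = (\<lambda>A B. \<Union>(r, s) \<in> A. \<Union>(r', s') \<in> B.
       loc_frac R S (r \<otimes>\<^bsub>R\<^esub> s' \<oplus>\<^bsub>R\<^esub> r' \<otimes>\<^bsub>R\<^esub> s) (s \<otimes>\<^bsub>R\<^esub> s'))\<rparr>"

abbreviation stalk :: "('a, 'm) ring_scheme \<Rightarrow> 'a set \<Rightarrow> ('a \<times> 'a) set ring" where
  "stalk R P \<equiv> localization R (carrier R - P)"

text \<open>The ring \<open>\<O>\<^sub>X(U)\<close> of sections over an open \<open>U\<close> of \<open>X = Spec R\<close>: families of elements of the local rings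
  that are locally given by a fraction. The restriction maps are restrictions of functions.\<close>

definition structure_ring ::
  "('a, 'm) ring_scheme \<Rightarrow> 'a set set \<Rightarrow> ('a set \<Rightarrow> ('a \<times> 'a) set) ring" where
  "structure_ring R U =
    \<lparr>carrier = {s \<in> \<Pi>\<^sub>E P \<in> U. carrier (stalk R P).
       \<forall>P \<in> U. \<exists>V. openin (zariski R) V \<and> P \<in> V \<and> V \<subseteq> U \<and>
         (\<exists>r \<in> carrier R. \<exists>f \<in> carrier R. \<forall>Q \<in> V. f \<notin> Q \<and> s Q = loc_frac R (carrier R - Q) r f)},
     mult = (\<lambda>s t. \<lambda>P \<in> U. s P \<otimes>\<^bsub>stalk R P\<^esub> t P),
     one = (\<lambda>P \<in> U. \<one>\<^bsub>stalk R P\<^esub>),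
     zero = (\<lambda>P \<in> U. \<zero>\<^bsub>stalk R P\<^esub>),
     add = (\<lambda>s t. \<lambda>P \<in> U. s P \<oplus>\<^bsub>stalk R P\<^esub> t P)\<rparr>"


section \<open>Unipotent units\<close>

definition nilradical :: "('a, 'm) ring_scheme \<Rightarrow> 'a set" where
  "nilradical A = {x \<in> carrier A. \<exists>n::nat. x [^]\<^bsub>A\<^esub> n = \<zero>\<^bsub>A\<^esub>}"

definition unipotent_units :: "('a, 'm) ring_scheme \<Rightarrow> 'a monoid" where
  "unipotent_units A =
    \<lparr>carrier = {\<one>\<^bsub>A\<^esub> \<oplus>\<^bsub>A\<^esub> x | x. x \<in> nilradical A}, mult = mult A, one = \<one>\<^bsub>A\<^esub>\<rparr>"

text \<open>The sheaf \<open>1 + \<N>\<close> on \<open>Spec R\<close>, where \<open>\<N>(U)\<close> is the nilradical of \<open>\<O>\<^sub>X(U)\<close>. This presheaf is a sheaf when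
  \<open>R\<close> is noetherian: every open set is then quasi-compact, so local nilpotence gives nilpotence.\<close>

definition one_plus_N :: "('a, 'm) ring_scheme \<Rightarrow> ('a set, 'a set \<Rightarrow> ('a \<times> 'a) set) presheaf" where
  "one_plus_N R =
    \<lparr>sections = (\<lambda>U. unipotent_units (structure_ring R U)), restr = (\<lambda>U V s. restrict s V)\<rparr>"

end

theory Submission
  imports Defs
begin

text \<open>Injective sheaves are flasque, and for the basic open sets \<open>D(f)\<close> every cover can be reduced to covers by
  two sets: a property that is inherited by smaller basic open sets and by unions \<open>V \<union> W\<close> of basic open sets that are
  again basic holds as soon as it holds locally. This makes higher Cech cohomology unnecessary. Suppose that, for basic
  \<open>V\<close>, \<open>W\<close> and \<open>V \<union> W\<close>, every section of \<open>F\<close> over \<open>V \<inter> W\<close> is a product of restrictions of sections over \<open>V\<close> and \<open>W\<close>.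
  If \<open>0 \<rightarrow> F \<rightarrow> I \<rightarrow> Q \<rightarrow> 0\<close> is exact, then local lifts of a section of \<open>Q\<close> to \<open>I\<close> can be corrected and glued, so
  \<open>I(B) \<rightarrow> Q(B)\<close> is surjective for basic \<open>B\<close>; as \<open>I\<close> is flasque, \<open>Q\<close> inherits the property. Applied along the
  resolution, this gives the vanishing of cohomology. For \<open>F = 1 + \<N>\<close>, a section over a basic open set is globally of
  the form \<open>1 + r/f\<close> with \<open>r\<close> nilpotent in \<open>R\<close>, and the property follows by writing \<open>r/f\<close> as a sum and
  induction on the order of nilpotence of \<open>r\<close>.\<close>

section \<open>Sheaves and restriction\<close>

text \<open>Splitting sections over \<open>V \<inter> W\<close> is the vanishing of the first Cech
  group of a two-element cover, and it depends on \<open>V \<union> W\<close> being basic. For R =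
  k[x,y,e]/(e^2) with k a field, 1 + N is a copy of the structure sheaf of the plane, and the
  section 1 + e/(xy) over D(x) \<inter> D(y) does not split: the union is the punctured plane. The
  cover induction must therefore steer around all unions that are not basic. Outside characteristic
  zero there is no exponential that makes 1 + N additive, so additive splittings of r/f only give
  multiplicative ones up to a correction of higher order in r. A section of 1 + N must be nilpotent
  with one exponent for the whole open set, so gluing has to preserve a uniform bound. Over basic
  sets this bound comes from a numerator that is nilpotent in R itself; the restriction and gluing
  properties of 1 + N are used only with basic sets as targets.\<close>

context ab_presheaf
begin

lemma group_sections: "openin X U \<Longrightarrow> group (sections F U)"
  by (rule comm_group.axioms(2)[OF comm_group_sections])

lemma group_hom_restr:
  "\<lbrakk>openin X U; openin X V; V \<subseteq> U\<rbrakk> \<Longrightarrow> group_hom (sections F U) (sections F V) (restr F U V)"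
  by (simp add: group_hom_def group_hom_axioms_def group_sections restr_hom)

lemma restr_closed:
  "\<lbrakk>openin X U; openin X V; V \<subseteq> U; s \<in> carrier (sections F U)\<rbrakk>
    \<Longrightarrow> restr F U V s \<in> carrier (sections F V)"
  by (rule hom_in_carrier[OF restr_hom])

end

context ab_sheaf
begin

lemma eq_if_locally_eq:
  assumes "openin X U" "s \<in> carrier (sections F U)" "t \<in> carrier (sections F U)"
    and loc: "\<And>x. x \<in> U \<Longrightarrow> \<exists>V. openin X V \<and> x \<in> V \<and> V \<subseteq> U \<and> restr F U V s = restr F U V t"
  shows "s = t"
proof -
  define \<U> where "\<U> = {V. openin X V \<and> V \<subseteq> U \<and> restr F U V s = restr F U V t}"
  have "\<Union>\<U> = U"
    unfolding \<U>_def using loc by blast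
  then show ?thesis
    using locality[of \<U> s t] assms(2,3) by (simp add: \<U>_def)
qed

text \<open>The empty family covers the empty set, so locality has nothing to check. This starts the
  cover inductions and makes sections over disjoint sets compatible.\<close>

lemma eq_on_empty:
  assumes "s \<in> carrier (sections F {})" "t \<in> carrier (sections F {})"
  shows "s = t"
  using assms by (intro eq_if_locally_eq[of "{}"]) auto

lemma binary_gluing:
  assumes V: "openin X V" "s \<in> carrier (sections F V)" and W: "openin X W" "t \<in> carrier (sections F W)"
    and eq: "restr F V (V \<inter> W) s = restr F W (V \<inter> W) t"
  shows "\<exists>c \<in> carrier (sections F (V \<union> W)). restr F (V \<union> W) V c = s \<and> restr F (V \<union> W) W c = t"
proof (cases "V = W")
  \<comment> \<open>\<open>gluing\<close> takes a family indexed by the open sets themselves, so two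
    sections over the same set do not form such a family; here the hypothesis already gives
    \<open>s = t\<close>.\<close>
  case True
  then show ?thesis
    using assms restr_id by auto
next
  case False
  define \<sigma> where "\<sigma> Y = (if Y = V then s else t)" for Y
  have "\<exists>c \<in> carrier (sections F (\<Union>{V, W})). \<forall>Y \<in> {V, W}. restr F (\<Union>{V, W}) Y c = \<sigma> Y"
  proof (rule gluing)
    show "restr F Y (Y \<inter> Z) (\<sigma> Y) = restr F Z (Y \<inter> Z) (\<sigma> Z)" if "Y \<in> {V, W}" "Z \<in> {V, W}" for Y Z
      using that eq False by (auto simp: \<sigma>_def Int_commute)
  qed (use assms in \<open>auto simp: \<sigma>_def\<close>)
  then show ?thesis
    using False by (auto simp: \<sigma>_def)
qed

end


section \<open>Injective sheaves are flasque\<close>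

text \<open>This is \<open>\<int>\<^sub>U\<close>, the constant sheaf on \<open>U\<close> extended by zero. As a function on the whole space, a section
  over \<open>V\<close> has the value \<open>0\<close> outside \<open>V\<close>.\<close>

definition int_sheaf :: "'x topology \<Rightarrow> 'x set \<Rightarrow> ('x, 'x \<Rightarrow> int) presheaf" where
  "int_sheaf X U =
    \<lparr>sections = (\<lambda>V. \<lparr>carrier = {a. (\<forall>x. x \<notin> V \<inter> U \<longrightarrow> a x = 0) \<and>
        (\<forall>x \<in> V. \<exists>W n. openin X W \<and> x \<in> W \<and> W \<subseteq> V \<and> (\<forall>y \<in> W. a y = n))},
      mult = (\<lambda>a b x. a x + b x), one = (\<lambda>x. 0)\<rparr>),
     restr = (\<lambda>V W a x. if x \<in> W then a x else 0)\<rparr>"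

lemma int_sheaf_sections:
  "a \<in> carrier (sections (int_sheaf X U) V) \<longleftrightarrow> (\<forall>x. x \<notin> V \<inter> U \<longrightarrow> a x = 0) \<and>
    (\<forall>x \<in> V. \<exists>W n. openin X W \<and> x \<in> W \<and> W \<subseteq> V \<and> (\<forall>y \<in> W. a y = n))"
  "mult (sections (int_sheaf X U) V) a b = (\<lambda>x. a x + b x)"
  "one (sections (int_sheaf X U) V) = (\<lambda>x. 0)"
  "restr (int_sheaf X U) V W a = (\<lambda>x. if x \<in> W then a x else 0)"
  by (simp_all add: int_sheaf_def)

lemma int_sheaf_add_closed:
  assumes a: "a \<in> carrier (sections (int_sheaf X U) V)" and b: "b \<in> carrier (sections (int_sheaf X U) V)"
  shows "(\<lambda>x. a x + b x) \<in> carrier (sections (int_sheaf X U) V)"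
  unfolding int_sheaf_sections
proof (intro conjI ballI)
  show "\<forall>x. x \<notin> V \<inter> U \<longrightarrow> a x + b x = 0"
    using a b by (simp add: int_sheaf_sections)
  fix x assume "x \<in> V"
  then obtain W W' n m where "openin X W" "x \<in> W" "W \<subseteq> V" "\<forall>y \<in> W. a y = n"
    and "openin X W'" "x \<in> W'" "W' \<subseteq> V" "\<forall>y \<in> W'. b y = m"
    using a b unfolding int_sheaf_sections by metis
  then show "\<exists>W n. openin X W \<and> x \<in> W \<and> W \<subseteq> V \<and> (\<forall>y\<in>W. a y + b y = n)"
    by (intro exI[of _ "W \<inter> W'"] exI[of _ "n + m"]) auto
qed

lemma comm_group_int_sheaf:
  assumes "openin X V"
  shows "comm_group (sections (int_sheaf X U) V)"
proof (rule comm_groupI)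
  show "\<one>\<^bsub>sections (int_sheaf X U) V\<^esub> \<in> carrier (sections (int_sheaf X U) V)"
    using assms by (auto simp: int_sheaf_sections)
next
  fix a assume a: "a \<in> carrier (sections (int_sheaf X U) V)"
  then have "(\<lambda>x. - a x) \<in> carrier (sections (int_sheaf X U) V)"
    unfolding int_sheaf_sections by (metis neg_equal_0_iff_equal)
  then show "\<exists>b \<in> carrier (sections (int_sheaf X U) V).
      b \<otimes>\<^bsub>sections (int_sheaf X U) V\<^esub> a = \<one>\<^bsub>sections (int_sheaf X U) V\<^esub>"
    by (rule rev_bexI) (simp add: int_sheaf_sections)
qed (simp_all add: int_sheaf_add_closed int_sheaf_sections(2,3) add_ac)

lemma int_sheaf_restr_closed:
  assumes "openin X V" "openin X W" "W \<subseteq> V" "a \<in> carrier (sections (int_sheaf X U) V)"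
  shows "restr (int_sheaf X U) V W a \<in> carrier (sections (int_sheaf X U) W)"
  unfolding int_sheaf_sections
proof (intro conjI ballI)
  show "\<forall>x. x \<notin> W \<inter> U \<longrightarrow> (if x \<in> W then a x else 0) = 0"
    using assms(3,4) by (auto simp: int_sheaf_sections)
  fix x assume x: "x \<in> W"
  then obtain W' n where "openin X W'" "x \<in> W'" "W' \<subseteq> V" "\<forall>y \<in> W'. a y = n"
    using assms(3,4) unfolding int_sheaf_sections by (meson subsetD)
  then show "\<exists>W' n. openin X W' \<and> x \<in> W' \<and> W' \<subseteq> W \<and> (\<forall>y\<in>W'. (if y \<in> W then a y else 0) = n)"
    using x assms(2) by (intro exI[of _ "W \<inter> W'"] exI[of _ n]) auto
qed

lemma ab_sheaf_int_sheaf: "ab_sheaf X (int_sheaf X U)"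
proof (intro ab_sheaf.intro ab_presheaf.intro ab_sheaf_axioms.intro)
  fix V W assume VW: "openin X V" "openin X W" "W \<subseteq> V"
  then show "restr (int_sheaf X U) V W \<in> hom (sections (int_sheaf X U) V) (sections (int_sheaf X U) W)"
    by (intro homI int_sheaf_restr_closed) (auto simp: int_sheaf_sections(2,4))
next
  fix V s assume "s \<in> carrier (sections (int_sheaf X U) V)"
  then show "restr (int_sheaf X U) V V s = s"
    by (auto simp: int_sheaf_sections)
next
  fix \<U> s t
  assume s: "s \<in> carrier (sections (int_sheaf X U) (\<Union>\<U>))" "t \<in> carrier (sections (int_sheaf X U) (\<Union>\<U>))"
    and eq: "\<And>V. V \<in> \<U> \<Longrightarrow> restr (int_sheaf X U) (\<Union>\<U>) V s = restr (int_sheaf X U) (\<Union>\<U>) V t"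
  show "s = t"
  proof
    fix x
    show "s x = t x"
    proof (cases "x \<in> \<Union>\<U>")
      case True
      then obtain V where "V \<in> \<U>" "x \<in> V"
        by blast
      then show ?thesis
        using fun_cong[OF eq, of V x] by (simp add: int_sheaf_sections)
    qed (use s in \<open>simp add: int_sheaf_sections\<close>)
  qed
next
  fix \<U> \<sigma>
  assume op: "\<And>V. V \<in> \<U> \<Longrightarrow> openin X V"
    and \<sigma>: "\<And>V. V \<in> \<U> \<Longrightarrow> \<sigma> V \<in> carrier (sections (int_sheaf X U) V)"
    and comp: "\<And>V W. \<lbrakk>V \<in> \<U>; W \<in> \<U>\<rbrakk> \<Longrightarrow>
      restr (int_sheaf X U) V (V \<inter> W) (\<sigma> V) = restr (int_sheaf X U) W (V \<inter> W) (\<sigma> W)"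
  \<comment> \<open>By compatibility, every member of the cover that contains x yields the same
    value, so an arbitrary choice is harmless.\<close>
  define s where "s x = (if x \<in> \<Union>\<U> then \<sigma> (SOME V. V \<in> \<U> \<and> x \<in> V) x else 0)" for x
  have s: "s x = \<sigma> V x" if V: "V \<in> \<U>" "x \<in> V" for x V
  proof -
    define W where "W = (SOME V. V \<in> \<U> \<and> x \<in> V)"
    have W: "W \<in> \<U> \<and> x \<in> W"
      unfolding W_def by (rule someI[of _ V]) (use that in blast)
    have "s x = \<sigma> W x"
      using that by (auto simp: s_def W_def)
    also have "\<dots> = \<sigma> V x"
      using fun_cong[OF comp[OF V(1), of W], of x] W V(2) by (simp add: int_sheaf_sections)
    finally show ?thesis .
  qed
  have "s \<in> carrier (sections (int_sheaf X U) (\<Union>\<U>))"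
    unfolding int_sheaf_sections
  proof (intro conjI allI impI ballI)
    fix x assume "x \<notin> \<Union>\<U> \<inter> U"
    then show "s x = 0"
    proof (cases "x \<in> \<Union>\<U>")
      case True
      then obtain V where "V \<in> \<U>" "x \<in> V"
        by blast
      then show ?thesis
        using s \<sigma>[of V] \<open>x \<notin> \<Union>\<U> \<inter> U\<close> by (auto simp: int_sheaf_sections)
    qed (simp add: s_def)
  next
    fix x assume "x \<in> \<Union>\<U>"
    then obtain V where V: "V \<in> \<U>" "x \<in> V"
      by blast
    then obtain W n where "openin X W" "x \<in> W" "W \<subseteq> V" "\<forall>y \<in> W. \<sigma> V y = n"
      using \<sigma>[OF V(1)] unfolding int_sheaf_sections by blast
    then show "\<exists>W n. openin X W \<and> x \<in> W \<and> W \<subseteq> \<Union>\<U> \<and> (\<forall>y \<in> W. s y = n)"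
      using s V by (intro exI[of _ W] exI[of _ n]) auto
  qed
  moreover have "restr (int_sheaf X U) (\<Union>\<U>) V s = \<sigma> V" if "V \<in> \<U>" for V
    using s[OF that] \<sigma>[OF that] by (auto simp: int_sheaf_sections)
  ultimately show "\<exists>s \<in> carrier (sections (int_sheaf X U) (\<Union>\<U>)).
      \<forall>V \<in> \<U>. restr (int_sheaf X U) (\<Union>\<U>) V s = \<sigma> V"
    by blast
qed (auto simp: comm_group_int_sheaf int_sheaf_sections(4) fun_eq_iff)

text \<open>A section \<open>s\<close> over \<open>U\<close> defines a homomorphism from \<open>\<int>\<^sub>U\<close> that sends the function \<open>a\<close> to
  \<open>s\<close> to the power \<open>a\<close>, computed locally; the exponent \<open>0\<close> is treated separately because \<open>s\<close> cannot be
  restricted to sets outside \<open>U\<close>.\<close>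

context ab_sheaf
begin

definition section_pow :: "'a set \<Rightarrow> 'b \<Rightarrow> 'a set \<Rightarrow> int \<Rightarrow> 'b" where
  "section_pow U s W n =
    (if n = 0 then \<one>\<^bsub>sections F W\<^esub> else restr F U W s [^]\<^bsub>sections F W\<^esub> n)"

text \<open>A relation rather than a function, because the power can be formed only where
  \<open>a\<close> is constant. Existence and uniqueness of \<open>t\<close> turn it into a map on
  sections.\<close>

definition locally_pow :: "'a set \<Rightarrow> 'b \<Rightarrow> 'a set \<Rightarrow> ('a \<Rightarrow> int) \<Rightarrow> 'b \<Rightarrow> bool" where
  "locally_pow U s V a t \<longleftrightarrow> t \<in> carrier (sections F V) \<and>
    (\<forall>x \<in> V. \<exists>W n. openin X W \<and> x \<in> W \<and> W \<subseteq> V \<and> (\<forall>y \<in> W. a y = n) \<and>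
      restr F V W t = section_pow U s W n)"

context
  fixes U s
  assumes U: "openin X U" and s: "s \<in> carrier (sections F U)"
begin

lemma section_pow_closed:
  assumes "openin X W" "n \<noteq> 0 \<Longrightarrow> W \<subseteq> U"
  shows "section_pow U s W n \<in> carrier (sections F W)"
  using assms U s group_sections[of W]
  by (auto simp: section_pow_def restr_closed intro!: group.int_pow_closed group.is_monoid monoid.one_closed)

lemma restr_section_pow:
  assumes "openin X W" "openin X W'" "W' \<subseteq> W" "n \<noteq> 0 \<Longrightarrow> W \<subseteq> U"
  shows "restr F W W' (section_pow U s W n) = section_pow U s W' n"
proof -
  interpret group_hom "sections F W" "sections F W'" "restr F W W'"
    using assms by (intro group_hom_restr)
  show ?thesis
    using assms U s by (auto simp: section_pow_def hom_int_pow restr_closed restr_comp)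
qed

lemma section_pow_add:
  assumes "openin X W" "n \<noteq> 0 \<Longrightarrow> W \<subseteq> U" "m \<noteq> 0 \<Longrightarrow> W \<subseteq> U"
  shows "section_pow U s W (n + m) = section_pow U s W n \<otimes>\<^bsub>sections F W\<^esub> section_pow U s W m"
proof -
  interpret G: group "sections F W"
    using assms by (intro group_sections)
  show ?thesis
  proof (cases "W \<subseteq> U")
    case True
    then have "restr F U W s \<in> carrier (sections F W)"
      using assms U s by (simp add: restr_closed)
    then show ?thesis
      by (auto simp: section_pow_def G.int_pow_mult[symmetric])
  qed (use assms in \<open>auto simp: section_pow_def\<close>)
qed

lemma locally_pow_nbhd:
  assumes t: "locally_pow U s V a t" and V: "openin X V" and a: "a \<in> carrier (sections (int_sheaf X U) V)"
    and x: "x \<in> V"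
  obtains W n where "openin X W" "x \<in> W" "W \<subseteq> V" "\<And>y. y \<in> W \<Longrightarrow> a y = n" "n \<noteq> 0 \<Longrightarrow> W \<subseteq> U"
    and "\<And>W'. \<lbrakk>openin X W'; W' \<subseteq> W\<rbrakk> \<Longrightarrow> restr F V W' t = section_pow U s W' n"
proof -
  obtain W n where W: "openin X W" "x \<in> W" "W \<subseteq> V" "\<forall>y \<in> W. a y = n"
      "restr F V W t = section_pow U s W n" and tV: "t \<in> carrier (sections F V)"
    using t x unfolding locally_pow_def by blast
  \<comment> \<open>\<open>a\<close> vanishes outside \<open>U\<close>, so a nonzero constant value
    on \<open>W\<close> forces \<open>W\<close> into \<open>U\<close>, where \<open>s\<close> can be
    restricted.\<close>
  have U0: "n \<noteq> 0 \<Longrightarrow> W \<subseteq> U"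
    using a W(4) by (fastforce simp: int_sheaf_sections)
  have "restr F V W' t = section_pow U s W' n" if "openin X W'" "W' \<subseteq> W" for W'
    using restr_comp[of V W W' t] restr_section_pow[of W W' n] that W tV V U0 by simp
  then show ?thesis
    using W by (intro that[of W n] U0) auto
qed

lemma locally_pow_unique:
  assumes t: "locally_pow U s V a t" and u: "locally_pow U s V a u" and V: "openin X V"
    and a: "a \<in> carrier (sections (int_sheaf X U) V)"
  shows "t = u"
proof (rule eq_if_locally_eq[of V])
  fix x assume x: "x \<in> V"
  obtain W n where W: "openin X W" "x \<in> W" "W \<subseteq> V" "\<And>y. y \<in> W \<Longrightarrow> a y = n" "n \<noteq> 0 \<Longrightarrow> W \<subseteq> U"
    "\<And>W'. \<lbrakk>openin X W'; W' \<subseteq> W\<rbrakk> \<Longrightarrow> restr F V W' t = section_pow U s W' n"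
    by (rule locally_pow_nbhd[OF t V a x]) (rule that)
  obtain W1 m where W1: "openin X W1" "x \<in> W1" "W1 \<subseteq> V" "\<And>y. y \<in> W1 \<Longrightarrow> a y = m" "m \<noteq> 0 \<Longrightarrow> W1 \<subseteq> U"
    "\<And>W'. \<lbrakk>openin X W'; W' \<subseteq> W1\<rbrakk> \<Longrightarrow> restr F V W' u = section_pow U s W' m"
    by (rule locally_pow_nbhd[OF u V a x]) (rule that)
  have "n = m"
    using W(2,4) W1(2,4) by metis
  then have "restr F V (W \<inter> W1) t = restr F V (W \<inter> W1) u"
    using W(1,6) W1(1,6) by (metis inf_le1 inf_le2 openin_Int)
  then show "\<exists>Y. openin X Y \<and> x \<in> Y \<and> Y \<subseteq> V \<and> restr F V Y t = restr F V Y u"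
    using W(1-3) W1(1-3) by (intro exI[of _ "W \<inter> W1"]) auto
qed (use assms in \<open>auto simp: locally_pow_def\<close>)

text \<open>The level sets of a locally constant function are open, cover \<open>V\<close> and are
  pairwise disjoint, so the powers of \<open>s\<close> on them glue: all overlaps of distinct level
  sets are empty.\<close>

lemma locally_pow_exists:
  assumes V: "openin X V" and a: "a \<in> carrier (sections (int_sheaf X U) V)"
  shows "\<exists>t. locally_pow U s V a t"
proof -
  define lev where "lev n = {x \<in> V. a x = n}" for n
  define \<U> where "\<U> = lev ` a ` V"
  \<comment> \<open>The family to be glued depends only on the set, so the exponent is read off at
    an arbitrary point of the level set.\<close>
  define \<sigma> where "\<sigma> W = section_pow U s W (a (SOME x. x \<in> W))" for W
  have lev_U: "lev n \<subseteq> U" if "n \<noteq> 0" for n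
    using a that by (auto simp: lev_def int_sheaf_sections)
  have lev_open: "openin X (lev n)" for n
  proof (subst openin_subopen, intro ballI)
    fix x assume x: "x \<in> lev n"
    then obtain W m where W: "openin X W" "x \<in> W" "W \<subseteq> V" "\<forall>y \<in> W. a y = m"
      using a unfolding int_sheaf_sections lev_def by blast
    then have "W \<subseteq> lev n"
      using x by (auto simp: lev_def)
    then show "\<exists>T. openin X T \<and> x \<in> T \<and> T \<subseteq> lev n"
      using W by blast
  qed
  have \<sigma>: "\<sigma> (lev (a x)) = section_pow U s (lev (a x)) (a x)" if "x \<in> V" for x
  proof -
    have "(SOME y. y \<in> lev (a x)) \<in> lev (a x)"
      by (rule someI[of _ x]) (simp add: lev_def that)
    then have "a (SOME y. y \<in> lev (a x)) = a x"
      by (simp add: lev_def)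
    then show ?thesis
      unfolding \<sigma>_def by (rule arg_cong)
  qed
  have \<U>V: "\<Union>\<U> = V"
    by (auto simp: \<U>_def lev_def)
  have closed: "\<sigma> W \<in> carrier (sections F W)" if "W \<in> \<U>" for W
    using that \<sigma> section_pow_closed[OF lev_open] lev_U by (auto simp: \<U>_def)
  have op: "openin X W" if "W \<in> \<U>" for W
    using that lev_open by (auto simp: \<U>_def)
  have "\<exists>t \<in> carrier (sections F (\<Union>\<U>)). \<forall>W \<in> \<U>. restr F (\<Union>\<U>) W t = \<sigma> W"
  proof (rule gluing)
    fix W W' assume W: "W \<in> \<U>" "W' \<in> \<U>"
    show "restr F W (W \<inter> W') (\<sigma> W) = restr F W' (W \<inter> W') (\<sigma> W')"
    proof (cases "W = W'")
      case False
      then have empty: "W \<inter> W' = {}"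
        using W by (auto simp: \<U>_def lev_def)
      show ?thesis
        unfolding empty by (rule eq_on_empty) (use restr_closed op closed W in auto)
    qed simp
  qed (use op closed in auto)
  then obtain t where t: "t \<in> carrier (sections F V)" "\<forall>W \<in> \<U>. restr F V W t = \<sigma> W"
    unfolding \<U>V by blast
  have "locally_pow U s V a t"
    unfolding locally_pow_def
  proof (intro conjI t ballI)
    fix x assume x: "x \<in> V"
    then have "restr F V (lev (a x)) t = section_pow U s (lev (a x)) (a x)"
      using t(2) \<sigma> by (auto simp: \<U>_def)
    then show "\<exists>W n. openin X W \<and> x \<in> W \<and> W \<subseteq> V \<and> (\<forall>y\<in>W. a y = n) \<and>
        restr F V W t = section_pow U s W n"
      using x lev_open by (intro exI[of _ "lev (a x)"] exI[of _ "a x"]) (auto simp: lev_def)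
  qed
  then show ?thesis ..
qed

lemma locally_pow_mult:
  assumes V: "openin X V" and a: "a \<in> carrier (sections (int_sheaf X U) V)"
    and b: "b \<in> carrier (sections (int_sheaf X U) V)"
    and t: "locally_pow U s V a t" and u: "locally_pow U s V b u"
  shows "locally_pow U s V (\<lambda>x. a x + b x) (t \<otimes>\<^bsub>sections F V\<^esub> u)"
  unfolding locally_pow_def
proof (intro conjI ballI)
  interpret G: group "sections F V"
    using V by (rule group_sections)
  have tu: "t \<in> carrier (sections F V)" "u \<in> carrier (sections F V)"
    using t u by (auto simp: locally_pow_def)
  then show "t \<otimes>\<^bsub>sections F V\<^esub> u \<in> carrier (sections F V)"
    by simp
  fix x assume x: "x \<in> V"
  obtain W n where W: "openin X W" "x \<in> W" "W \<subseteq> V" "\<And>y. y \<in> W \<Longrightarrow> a y = n" "n \<noteq> 0 \<Longrightarrow> W \<subseteq> U"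
    "\<And>W'. \<lbrakk>openin X W'; W' \<subseteq> W\<rbrakk> \<Longrightarrow> restr F V W' t = section_pow U s W' n"
    by (rule locally_pow_nbhd[OF t V a x]) (rule that)
  obtain W1 m where W1: "openin X W1" "x \<in> W1" "W1 \<subseteq> V" "\<And>y. y \<in> W1 \<Longrightarrow> b y = m" "m \<noteq> 0 \<Longrightarrow> W1 \<subseteq> U"
    "\<And>W'. \<lbrakk>openin X W'; W' \<subseteq> W1\<rbrakk> \<Longrightarrow> restr F V W' u = section_pow U s W' m"
    by (rule locally_pow_nbhd[OF u V b x]) (rule that)
  define Y where "Y = W \<inter> W1"
  have Y: "openin X Y" "x \<in> Y" "Y \<subseteq> V" "Y \<subseteq> W" "Y \<subseteq> W1"
    using W W1 by (auto simp: Y_def)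
  have "restr F V Y (t \<otimes>\<^bsub>sections F V\<^esub> u) = section_pow U s Y n \<otimes>\<^bsub>sections F Y\<^esub> section_pow U s Y m"
    using hom_mult[OF restr_hom[OF V Y(1,3)] tu] W(6)[OF Y(1,4)] W1(6)[OF Y(1,5)] by simp
  also have "\<dots> = section_pow U s Y (n + m)"
    by (rule section_pow_add[symmetric]) (use Y W(5) W1(5) in blast)+
  finally show "\<exists>W n. openin X W \<and> x \<in> W \<and> W \<subseteq> V \<and> (\<forall>y\<in>W. a y + b y = n) \<and>
      restr F V W (t \<otimes>\<^bsub>sections F V\<^esub> u) = section_pow U s W n"
    using Y W(4) W1(4) by (intro exI[of _ Y] exI[of _ "n + m"]) (auto simp: subset_iff)
qed

lemma locally_pow_restr:
  assumes V: "openin X V" "openin X V'" "V' \<subseteq> V" and a: "a \<in> carrier (sections (int_sheaf X U) V)"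
    and t: "locally_pow U s V a t"
  shows "locally_pow U s V' (restr (int_sheaf X U) V V' a) (restr F V V' t)"
  unfolding locally_pow_def
proof (intro conjI ballI)
  have tV: "t \<in> carrier (sections F V)"
    using t by (auto simp: locally_pow_def)
  then show "restr F V V' t \<in> carrier (sections F V')"
    using V by (simp add: restr_closed)
  fix x assume x: "x \<in> V'"
  then have "x \<in> V"
    using V by blast
  obtain W n
    where W: "openin X W" "x \<in> W" "W \<subseteq> V" "\<And>y. y \<in> W \<Longrightarrow> a y = n" "n \<noteq> 0 \<Longrightarrow> W \<subseteq> U"
    "\<And>W'. \<lbrakk>openin X W'; W' \<subseteq> W\<rbrakk> \<Longrightarrow> restr F V W' t = section_pow U s W' n"
    by (rule locally_pow_nbhd[OF t V(1) a \<open>x \<in> V\<close>]) (rule that)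
  have Y: "openin X (W \<inter> V')" "W \<inter> V' \<subseteq> W"
    using W V by auto
  have "restr F V' (W \<inter> V') (restr F V V' t) = restr F V (W \<inter> V') t"
    using V W tV by (intro restr_comp) auto
  then have "restr F V' (W \<inter> V') (restr F V V' t) = section_pow U s (W \<inter> V') n"
    using W(6)[OF Y] by simp
  then show "\<exists>W n. openin X W \<and> x \<in> W \<and> W \<subseteq> V' \<and> (\<forall>y\<in>W. restr (int_sheaf X U) V V' a y = n) \<and>
      restr F V' W (restr F V V' t) = section_pow U s W n"
    using x W(2,4) Y by (intro exI[of _ "W \<inter> V'"] exI[of _ n]) (auto simp: int_sheaf_sections)
qed

text \<open>The surjective half of Hom(Z_U, F) = F(U): the generator, the indicator function of
  \<open>U\<close>, can be sent to any prescribed section.\<close>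

lemma hom_from_int_sheaf:
  obtains f where "presheaf_hom X (int_sheaf X U) F f" "f U (\<lambda>x. if x \<in> U then 1 else 0) = s"
proof -
  define f where "f V a = (SOME t. locally_pow U s V a t)" for V a
  have f: "locally_pow U s V a (f V a)" if "openin X V" "a \<in> carrier (sections (int_sheaf X U) V)" for V a
    unfolding f_def using locally_pow_exists[OF that] by (rule someI_ex)
  have f_eq: "f V a = t" if "openin X V" "a \<in> carrier (sections (int_sheaf X U) V)" "locally_pow U s V a t" for V a t
    using locally_pow_unique[OF f] that by blast
  have "presheaf_hom X (int_sheaf X U) F f"
    unfolding presheaf_hom_def
  proof (intro conjI allI impI ballI homI)
    fix V a assume V: "openin X V" and a: "a \<in> carrier (sections (int_sheaf X U) V)"
    then show "f V a \<in> carrier (sections F V)"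
      using f by (auto simp: locally_pow_def)
    fix b assume b: "b \<in> carrier (sections (int_sheaf X U) V)"
    show "f V (a \<otimes>\<^bsub>sections (int_sheaf X U) V\<^esub> b) = f V a \<otimes>\<^bsub>sections F V\<^esub> f V b"
      unfolding int_sheaf_sections(2)
      by (intro f_eq V int_sheaf_add_closed a b locally_pow_mult f)
  next
    fix V V' a assume "openin X V" "openin X V'" "V' \<subseteq> V" "a \<in> carrier (sections (int_sheaf X U) V)"
    then show "f V' (restr (int_sheaf X U) V V' a) = restr F V V' (f V a)"
      by (intro f_eq int_sheaf_restr_closed locally_pow_restr f)
  qed
  moreover have "f U (\<lambda>x. if x \<in> U then 1 else 0) = s"
  proof (rule f_eq[OF U])
    show "(\<lambda>x. if x \<in> U then 1 else 0) \<in> carrier (sections (int_sheaf X U) U)"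
      using U by (auto simp: int_sheaf_sections)
    interpret G: group "sections F U"
      using U by (rule group_sections)
    show "locally_pow U s U (\<lambda>x. if x \<in> U then 1 else 0) s"
      using U s restr_id by (auto simp: locally_pow_def section_pow_def intro!: exI[of _ U] exI[of _ "1::int"])
  qed
  ultimately show ?thesis
    using that by blast
qed

end

end

text \<open>Injectivity extends the homomorphism from Z_U given by \<open>s\<close> to the constant
  sheaf; the image of the constant function 1 on the whole space is the required extension of
  \<open>s\<close>.\<close>

lemma injective_sheaf_flasque:
  assumes I: "injective_sheaf X I" and U: "openin X U" and s: "s \<in> carrier (sections I U)"
  obtains t where "t \<in> carrier (sections I (topspace X))" "restr I (topspace X) U t = s"
proof -
  interpret ab_sheaf X I
    using I by (simp add: injective_sheaf_def)
  \<comment> \<open>With \<open>UNIV\<close> the only vanishing condition left is outside the open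
    set in question, so \<open>?B\<close> is the constant sheaf Z. Extension by zero is built into
    the functions, so the inclusion is the identity.\<close>
  let ?A = "int_sheaf X U" and ?B = "int_sheaf X UNIV" and ?\<iota> = "\<lambda>V a. a"
  define e where "e V = (\<lambda>x. if x \<in> V then 1 else 0 :: int)" for V :: "'a set"
  obtain f where f: "presheaf_hom X ?A I f" "f U (e U) = s"
    using hom_from_int_sheaf[OF U s] by (auto simp: e_def)
  have "presheaf_mono X ?A ?B ?\<iota>"
    by (auto simp: presheaf_mono_def presheaf_hom_def hom_def int_sheaf_sections)
  then obtain g where g: "presheaf_hom X ?B I g"
      "\<And>V a. \<lbrakk>openin X V; a \<in> carrier (sections ?A V)\<rbrakk> \<Longrightarrow> g V a = f V a"
    using I f(1) ab_sheaf_int_sheaf[of X] unfolding injective_sheaf_def by metis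
  have e: "e V \<in> carrier (sections ?B V)" "e V \<in> carrier (sections (int_sheaf X V) V)" if "openin X V" for V
    using that by (auto simp: int_sheaf_sections e_def)
  have "restr I (topspace X) U (g (topspace X) (e (topspace X))) = g U (restr ?B (topspace X) U (e (topspace X)))"
    using g(1) U e(1) openin_subset[OF U] by (auto simp: presheaf_hom_def)
  also have "restr ?B (topspace X) U (e (topspace X)) = e U"
    using openin_subset[OF U] by (force simp: e_def int_sheaf_sections)
  also have "g U (e U) = s"
    using g(2) U e(2) f(2) by simp
  finally show ?thesis
    using that g(1) e(1) by (metis hom_in_carrier openin_topspace presheaf_hom_def)
qed


section \<open>Acyclicity from two-element covers\<close>

text \<open>\<open>cover_induct\<close> expresses quasi-compactness in a form that passes only
  through unions belonging to the basis. \<open>P {}\<close> is a separate clause because an empty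
  basic set offers no point at which to start.\<close>

locale binary_cover_basis =
  fixes X :: "'x topology" and \<B> :: "'x set set"
  assumes basis_open: "B \<in> \<B> \<Longrightarrow> openin X B"
    and basis_Int: "\<lbrakk>B \<in> \<B>; B' \<in> \<B>\<rbrakk> \<Longrightarrow> B \<inter> B' \<in> \<B>"
    and basis_topspace: "topspace X \<in> \<B>"
    and basis_nbhd: "\<lbrakk>openin X U; x \<in> U\<rbrakk> \<Longrightarrow> \<exists>B \<in> \<B>. x \<in> B \<and> B \<subseteq> U"
    and cover_induct: "\<lbrakk>B \<in> \<B>; P {};
      \<And>V W. \<lbrakk>V \<in> \<B>; W \<in> \<B>; W \<subseteq> V; P V\<rbrakk> \<Longrightarrow> P W;
      \<And>V W. \<lbrakk>V \<in> \<B>; W \<in> \<B>; V \<union> W \<in> \<B>; P V; P W\<rbrakk> \<Longrightarrow> P (V \<union> W);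
      \<And>x. x \<in> B \<Longrightarrow> \<exists>V \<in> \<B>. x \<in> V \<and> V \<subseteq> B \<and> P V\<rbrakk> \<Longrightarrow> P B"

text \<open>A section in the image is locally in the image, with \<open>U\<close> itself as
  neighbourhood. The assumptions on \<open>s\<close> stand in for the presheaf axioms of
  \<open>G\<close>.\<close>

lemma sheaf_exact_comp:
  assumes "sheaf_exact X F G H \<phi> \<psi>" and U: "openin X U" and t: "t \<in> carrier (sections F U)"
    and s: "\<phi> U t \<in> carrier (sections G U)" "restr G U U (\<phi> U t) = \<phi> U t"
  shows "\<psi> U (\<phi> U t) = \<one>\<^bsub>sections H U\<^esub>"
proof -
  have "\<psi> U (\<phi> U t) = \<one>\<^bsub>sections H U\<^esub> \<longleftrightarrow> (\<forall>x \<in> U. \<exists>V. openin X V \<and> x \<in> V \<and> V \<subseteq> U \<and>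
      (\<exists>t' \<in> carrier (sections F V). \<phi> V t' = restr G U V (\<phi> U t)))"
    using assms unfolding sheaf_exact_def by simp
  moreover have "\<exists>V. openin X V \<and> x \<in> V \<and> V \<subseteq> U \<and>
      (\<exists>t' \<in> carrier (sections F V). \<phi> V t' = restr G U V (\<phi> U t))" if "x \<in> U" for x
    using U t s(2) that by (intro exI[of _ U]) auto
  ultimately show ?thesis
    by blast
qed

lemma sheaf_exact_local:
  assumes "sheaf_exact X F G H \<phi> \<psi>" "openin X U" "s \<in> carrier (sections G U)"
    and "\<psi> U s = \<one>\<^bsub>sections H U\<^esub>" "x \<in> U"
  obtains V t where "openin X V" "x \<in> V" "V \<subseteq> U" "t \<in> carrier (sections F V)" "\<phi> V t = restr G U V s"
proof -
  have "\<forall>x \<in> U. \<exists>V. openin X V \<and> x \<in> V \<and> V \<subseteq> U \<and> (\<exists>t \<in> carrier (sections F V). \<phi> V t = restr G U V s)"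
    using assms unfolding sheaf_exact_def by simp
  then show ?thesis
    using \<open>x \<in> U\<close> that by meson
qed

text \<open>The conditions on \<open>F\<close> are sheaf conditions tested on the basis, where 1 + N
  has an explicit description. \<open>F_mayer_vietoris\<close> is the only one that a general sheaf
  may violate.\<close>

locale binary_cover_resolution = binary_cover_basis X \<B>
  for X :: "'x topology" and \<B> +
  fixes F :: "('x, 'f) presheaf" and I :: "nat \<Rightarrow> ('x, 'b) presheaf" and \<epsilon> d
  assumes resolution: "injective_resolution X F I \<epsilon> d"
    and F_empty: "carrier (sections F {}) \<noteq> {}"
    and F_restr_closed: "\<lbrakk>openin X U; V \<in> \<B>; V \<subseteq> U; s \<in> carrier (sections F U)\<rbrakk>
      \<Longrightarrow> restr F U V s \<in> carrier (sections F V)"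
    and F_gluing: "\<lbrakk>V \<in> \<B>; W \<in> \<B>; V \<union> W \<in> \<B>; s \<in> carrier (sections F V); t \<in> carrier (sections F W);
        restr F V (V \<inter> W) s = restr F W (V \<inter> W) t\<rbrakk>
      \<Longrightarrow> \<exists>c \<in> carrier (sections F (V \<union> W)). restr F (V \<union> W) V c = s \<and> restr F (V \<union> W) W c = t"
    and F_mayer_vietoris: "\<lbrakk>V \<in> \<B>; W \<in> \<B>; V \<union> W \<in> \<B>; s \<in> carrier (sections F (V \<inter> W))\<rbrakk>
      \<Longrightarrow> \<exists>a \<in> carrier (sections F V). \<exists>b \<in> carrier (sections F W).
        s = restr F V (V \<inter> W) a \<otimes>\<^bsub>sections F (V \<inter> W)\<^esub> restr F W (V \<inter> W) b"
begin

lemma ab_sheaf_I: "ab_sheaf X (I n)"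
  using resolution by (simp add: injective_resolution_def injective_sheaf_def)

sublocale I: ab_sheaf X "I n" for n
  by (rule ab_sheaf_I)

lemma d_hom: "openin X U \<Longrightarrow> d n U \<in> hom (sections (I n) U) (sections (I (Suc n)) U)"
  using resolution by (simp add: injective_resolution_def presheaf_hom_def)

lemma group_hom_d: "openin X U \<Longrightarrow> group_hom (sections (I n) U) (sections (I (Suc n)) U) (d n U)"
  by (simp add: group_hom_def group_hom_axioms_def I.group_sections d_hom)

lemma d_closed: "\<lbrakk>openin X U; s \<in> carrier (sections (I n) U)\<rbrakk> \<Longrightarrow> d n U s \<in> carrier (sections (I (Suc n)) U)"
  using hom_in_carrier[OF d_hom] .

lemma d_restr:
  "\<lbrakk>openin X U; openin X V; V \<subseteq> U; s \<in> carrier (sections (I n) U)\<rbrakk>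
    \<Longrightarrow> d n V (restr (I n) U V s) = restr (I (Suc n)) U V (d n U s)"
  using resolution by (simp add: injective_resolution_def presheaf_hom_def)

lemma \<epsilon>_hom: "openin X U \<Longrightarrow> \<epsilon> U \<in> hom (sections F U) (sections (I 0) U)"
  using resolution by (simp add: injective_resolution_def presheaf_mono_def presheaf_hom_def)

lemma \<epsilon>_closed: "\<lbrakk>openin X U; s \<in> carrier (sections F U)\<rbrakk> \<Longrightarrow> \<epsilon> U s \<in> carrier (sections (I 0) U)"
  using hom_in_carrier[OF \<epsilon>_hom] .

lemma \<epsilon>_restr:
  "\<lbrakk>openin X U; openin X V; V \<subseteq> U; s \<in> carrier (sections F U)\<rbrakk>
    \<Longrightarrow> \<epsilon> V (restr F U V s) = restr (I 0) U V (\<epsilon> U s)"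
  using resolution by (simp add: injective_resolution_def presheaf_mono_def presheaf_hom_def)

lemma \<epsilon>_inj: "openin X U \<Longrightarrow> inj_on (\<epsilon> U) (carrier (sections F U))"
  using resolution by (simp add: injective_resolution_def presheaf_mono_def)

text \<open>The resolution breaks into the sequences 0 -> \<open>Z n\<close> -> \<open>I n\<close>
  -> \<open>Z (Suc n)\<close> -> 0, so \<open>Z (Suc n)\<close> serves as the quotient of
  \<open>I n\<close> by \<open>Z n\<close>, and \<open>Z 0\<close> as a copy of
  \<open>F\<close>.\<close>

definition Z :: "nat \<Rightarrow> 'x set \<Rightarrow> 'b set" where
  "Z n U = kernel (sections (I n) U) (sections (I (Suc n)) U) (d n U)"

lemma Z_iff: "z \<in> Z n U \<longleftrightarrow> z \<in> carrier (sections (I n) U) \<and> d n U z = \<one>\<^bsub>sections (I (Suc n)) U\<^esub>"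
  by (simp add: Z_def kernel_def)

lemma subgroup_Z: "openin X U \<Longrightarrow> subgroup (Z n U) (sections (I n) U)"
  unfolding Z_def using group_hom.subgroup_kernel[OF group_hom_d] .

lemma d_in_Z:
  assumes U: "openin X U" and s: "s \<in> carrier (sections (I n) U)"
  shows "d n U s \<in> Z (Suc n) U"
proof -
  have ex: "sheaf_exact X (I n) (I (Suc n)) (I (Suc (Suc n))) (d n) (d (Suc n))"
    using resolution by (simp add: injective_resolution_def)
  show ?thesis
    using sheaf_exact_comp[OF ex U s] I.restr_id[OF U d_closed[OF U s]] d_closed[OF U s] unfolding Z_iff by simp
qed

lemma Z_locally_d:
  assumes U: "openin X U" and z: "z \<in> Z (Suc n) U" and x: "x \<in> U"
  shows "\<exists>V \<in> \<B>. x \<in> V \<and> V \<subseteq> U \<and> (\<exists>t \<in> carrier (sections (I n) V). d n V t = restr (I (Suc n)) U V z)"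
proof -
  have "sheaf_exact X (I n) (I (Suc n)) (I (Suc (Suc n))) (d n) (d (Suc n))"
    using resolution by (simp add: injective_resolution_def)
  then obtain V t where V: "openin X V" "x \<in> V" "V \<subseteq> U" "t \<in> carrier (sections (I n) V)"
      "d n V t = restr (I (Suc n)) U V z"
    using z x unfolding Z_iff by (elim sheaf_exact_local[OF _ U]) auto
  obtain B where B: "B \<in> \<B>" "x \<in> B" "B \<subseteq> V"
    using basis_nbhd[OF V(1,2)] by blast
  then have "d n B (restr (I n) V B t) = restr (I (Suc n)) U B z"
    using V U z basis_open[of B] by (simp add: d_restr I.restr_comp Z_iff)
  then show ?thesis
    using B V basis_open[of B] I.restr_closed[of V B t] by (intro bexI[of _ B]) auto
qed

lemma \<epsilon>_in_Z:
  assumes U: "openin X U" and s: "s \<in> carrier (sections F U)"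
  shows "\<epsilon> U s \<in> Z 0 U"
proof -
  have ex: "sheaf_exact X F (I 0) (I (Suc 0)) \<epsilon> (d 0)"
    using resolution by (simp add: injective_resolution_def)
  show ?thesis
    using sheaf_exact_comp[OF ex U s] I.restr_id[OF U \<epsilon>_closed[OF U s]] \<epsilon>_closed[OF U s] unfolding Z_iff by simp
qed

lemma Z_locally_\<epsilon>:
  assumes U: "openin X U" and z: "z \<in> Z 0 U" and x: "x \<in> U"
  shows "\<exists>V \<in> \<B>. x \<in> V \<and> V \<subseteq> U \<and> (\<exists>t \<in> carrier (sections F V). \<epsilon> V t = restr (I 0) U V z)"
proof -
  have "sheaf_exact X F (I 0) (I (Suc 0)) \<epsilon> (d 0)"
    using resolution by (simp add: injective_resolution_def)
  then obtain V t where V: "openin X V" "x \<in> V" "V \<subseteq> U" "t \<in> carrier (sections F V)"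
      "\<epsilon> V t = restr (I 0) U V z"
    using z x unfolding Z_iff by (elim sheaf_exact_local[OF _ U]) auto
  obtain B where B: "B \<in> \<B>" "x \<in> B" "B \<subseteq> V"
    using basis_nbhd[OF V(1,2)] by blast
  then have "\<epsilon> B (restr F V B t) = restr (I 0) U B z"
    using V U z basis_open[of B] by (simp add: \<epsilon>_restr I.restr_comp Z_iff)
  then show ?thesis
    using B V F_restr_closed[of V B t] by (intro bexI[of _ B]) auto
qed

text \<open>Local preimages under \<open>\<epsilon>\<close> agree on overlaps by injectivity, hence
  glue. As \<open>F\<close> glues two basic sets at a time, the gluing runs through the cover
  induction.\<close>

lemma Z_0_eq:
  assumes B: "B \<in> \<B>" and z: "z \<in> Z 0 B"
  shows "\<exists>t \<in> carrier (sections F B). \<epsilon> B t = z"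
proof -
  define P where "P V \<longleftrightarrow> V \<subseteq> B \<and> (\<exists>t \<in> carrier (sections F V). \<epsilon> V t = restr (I 0) B V z)" for V
  note oB = basis_open[OF B]
  have zI: "z \<in> carrier (sections (I 0) B)"
    using z by (simp add: Z_iff)
  obtain t0 where t0: "t0 \<in> carrier (sections F {})"
    using F_empty by blast
  have "P {}"
    unfolding P_def
  proof (intro conjI bexI[OF _ t0])
    show "\<epsilon> {} t0 = restr (I 0) B {} z"
      by (rule I.eq_on_empty[of _ 0]) (use t0 zI oB in \<open>auto simp: \<epsilon>_closed I.restr_closed\<close>)
  qed simp
  then have "P B"
  proof (rule cover_induct[OF B])
    fix V W assume V: "V \<in> \<B>" and W: "W \<in> \<B>" "W \<subseteq> V" and "P V"
    then obtain t where t: "V \<subseteq> B" "t \<in> carrier (sections F V)" "\<epsilon> V t = restr (I 0) B V z"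
      by (auto simp: P_def)
    have "\<epsilon> W (restr F V W t) = restr (I 0) B W z"
      using V W t zI oB by (simp add: \<epsilon>_restr I.restr_comp basis_open)
    then show "P W"
      using F_restr_closed[OF basis_open[OF V] W t(2)] W(2) t(1) by (auto simp: P_def)
  next
    fix V W assume V: "V \<in> \<B>" and W: "W \<in> \<B>" and VW: "V \<union> W \<in> \<B>" and "P V" "P W"
    then obtain t u where t: "V \<subseteq> B" "t \<in> carrier (sections F V)" "\<epsilon> V t = restr (I 0) B V z"
      and u: "W \<subseteq> B" "u \<in> carrier (sections F W)" "\<epsilon> W u = restr (I 0) B W z"
      by (auto simp: P_def)
    note o = basis_open[OF V] basis_open[OF W] basis_open[OF VW] openin_Int[OF basis_open[OF V] basis_open[OF W]]
    have ViW: "V \<inter> W \<in> \<B>"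
      using V W by (rule basis_Int)
    have "\<epsilon> (V \<inter> W) (restr F V (V \<inter> W) t) = \<epsilon> (V \<inter> W) (restr F W (V \<inter> W) u)"
      using o t u zI oB by (simp add: \<epsilon>_restr I.restr_comp)
    then have "restr F V (V \<inter> W) t = restr F W (V \<inter> W) u"
      using inj_onD[OF \<epsilon>_inj[OF o(4)]] F_restr_closed ViW o t u by simp
    then obtain c where c: "c \<in> carrier (sections F (V \<union> W))" "restr F (V \<union> W) V c = t" "restr F (V \<union> W) W c = u"
      using F_gluing[OF V W VW t(2) u(2)] by blast
    have "\<epsilon> (V \<union> W) c = restr (I 0) B (V \<union> W) z"
    proof (rule I.eq_if_locally_eq[OF o(3)])
      have "restr (I 0) (V \<union> W) V (\<epsilon> (V \<union> W) c) = restr (I 0) (V \<union> W) V (restr (I 0) B (V \<union> W) z)"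
        using \<epsilon>_restr[of "V \<union> W" V c] c t o oB u zI by (simp add: I.restr_comp)
      moreover have "restr (I 0) (V \<union> W) W (\<epsilon> (V \<union> W) c) = restr (I 0) (V \<union> W) W (restr (I 0) B (V \<union> W) z)"
        using \<epsilon>_restr[of "V \<union> W" W c] c t o oB u zI by (simp add: I.restr_comp)
      ultimately show "\<exists>Y. openin X Y \<and> x \<in> Y \<and> Y \<subseteq> V \<union> W \<and>
          restr (I 0) (V \<union> W) Y (\<epsilon> (V \<union> W) c) = restr (I 0) (V \<union> W) Y (restr (I 0) B (V \<union> W) z)"
        if "x \<in> V \<union> W" for x
        using that o by blast
    qed (use c o oB t u zI in \<open>auto simp: \<epsilon>_closed I.restr_closed\<close>)
    then show "P (V \<union> W)"
      using t u c by (auto simp: P_def)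
  next
    fix x assume "x \<in> B"
    then show "\<exists>V \<in> \<B>. x \<in> V \<and> V \<subseteq> B \<and> P V"
      using Z_locally_\<epsilon>[OF oB z] by (auto simp: P_def)
  qed
  then show ?thesis
    using I.restr_id[OF oB zI] by (simp add: P_def)
qed

text \<open>The first Cech group of \<open>Z n\<close> vanishes for the cover of
  \<open>V \<union> W\<close> by \<open>V\<close> and \<open>W\<close>.\<close>

definition mayer_vietoris :: "nat \<Rightarrow> bool" where
  "mayer_vietoris n \<longleftrightarrow> (\<forall>V W z. V \<in> \<B> \<longrightarrow> W \<in> \<B> \<longrightarrow> V \<union> W \<in> \<B> \<longrightarrow> z \<in> Z n (V \<inter> W) \<longrightarrow>
    (\<exists>a \<in> Z n V. \<exists>b \<in> Z n W.
      z = restr (I n) V (V \<inter> W) a \<otimes>\<^bsub>sections (I n) (V \<inter> W)\<^esub> restr (I n) W (V \<inter> W) b))"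

lemma mayer_vietoris_0: "mayer_vietoris 0"
  unfolding mayer_vietoris_def
proof (intro allI impI)
  fix V W z assume V: "V \<in> \<B>" and W: "W \<in> \<B>" and VW: "V \<union> W \<in> \<B>" and z: "z \<in> Z 0 (V \<inter> W)"
  note o = basis_open[OF V] basis_open[OF W] openin_Int[OF basis_open[OF V] basis_open[OF W]]
  have ViW: "V \<inter> W \<in> \<B>"
    using V W by (rule basis_Int)
  obtain t where t: "t \<in> carrier (sections F (V \<inter> W))" "\<epsilon> (V \<inter> W) t = z"
    using Z_0_eq[OF ViW z] by blast
  then obtain a b where a: "a \<in> carrier (sections F V)" and b: "b \<in> carrier (sections F W)"
    and t_eq: "t = restr F V (V \<inter> W) a \<otimes>\<^bsub>sections F (V \<inter> W)\<^esub> restr F W (V \<inter> W) b"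
    using F_mayer_vietoris[OF V W VW] by blast
  have ab: "restr F V (V \<inter> W) a \<in> carrier (sections F (V \<inter> W))"
      "restr F W (V \<inter> W) b \<in> carrier (sections F (V \<inter> W))"
    using F_restr_closed ViW o a b by simp_all
  have "z = restr (I 0) V (V \<inter> W) (\<epsilon> V a) \<otimes>\<^bsub>sections (I 0) (V \<inter> W)\<^esub> restr (I 0) W (V \<inter> W) (\<epsilon> W b)"
    using t(2) hom_mult[OF \<epsilon>_hom[OF o(3)] ab] o a b by (simp add: t_eq \<epsilon>_restr)
  then show "\<exists>a \<in> Z 0 V. \<exists>b \<in> Z 0 W.
      z = restr (I 0) V (V \<inter> W) a \<otimes>\<^bsub>sections (I 0) (V \<inter> W)\<^esub> restr (I 0) W (V \<inter> W) b"
    using \<epsilon>_in_Z o a b by blast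
qed

text \<open>Preimages of \<open>z\<close> exist locally by exactness. The cover induction applies
  because preimages over \<open>V\<close> and \<open>W\<close> differ on the overlap by a section of
  \<open>Z n\<close>, which can be split.\<close>

lemma d_surj:
  assumes mv: "mayer_vietoris n" and B: "B \<in> \<B>" and z: "z \<in> Z (Suc n) B"
  shows "\<exists>y \<in> carrier (sections (I n) B). d n B y = z"
proof -
  define P where "P V \<longleftrightarrow> V \<subseteq> B \<and> (\<exists>y \<in> carrier (sections (I n) V). d n V y = restr (I (Suc n)) B V z)" for V
  note oB = basis_open[OF B]
  have zI: "z \<in> carrier (sections (I (Suc n)) B)"
    using z by (simp add: Z_iff)
  interpret E: group_hom "sections (I n) {}" "sections (I (Suc n)) {}" "d n {}"
    by (rule group_hom_d) simp
  have "P {}"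
    unfolding P_def
  proof (intro conjI bexI[OF _ E.G.one_closed])
    show "d n {} \<one>\<^bsub>sections (I n) {}\<^esub> = restr (I (Suc n)) B {} z"
      by (rule I.eq_on_empty[of _ "Suc n"]) (use zI oB in \<open>auto simp: I.restr_closed\<close>)
  qed simp
  then have "P B"
  proof (rule cover_induct[OF B])
    fix V W assume V: "V \<in> \<B>" and W: "W \<in> \<B>" "W \<subseteq> V" and "P V"
    then obtain y where y: "V \<subseteq> B" "y \<in> carrier (sections (I n) V)" "d n V y = restr (I (Suc n)) B V z"
      by (auto simp: P_def)
    have "d n W (restr (I n) V W y) = restr (I (Suc n)) B W z"
      using V W y zI oB by (simp add: d_restr I.restr_comp basis_open)
    then show "P W"
      using I.restr_closed[OF basis_open[OF V] basis_open[OF W(1)] W(2) y(2)] W(2) y(1) by (auto simp: P_def)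
  next
    fix V W assume V: "V \<in> \<B>" and W: "W \<in> \<B>" and VW: "V \<union> W \<in> \<B>" and "P V" "P W"
    then obtain y y' where y: "V \<subseteq> B" "y \<in> carrier (sections (I n) V)" "d n V y = restr (I (Suc n)) B V z"
      and y': "W \<subseteq> B" "y' \<in> carrier (sections (I n) W)" "d n W y' = restr (I (Suc n)) B W z"
      by (auto simp: P_def)
    define Y where "Y = V \<inter> W"
    note o = basis_open[OF V] basis_open[OF W] basis_open[OF VW]
    have oY: "openin X Y" and Y: "Y \<subseteq> V" "Y \<subseteq> W"
      using o by (auto simp: Y_def)
    interpret V: comm_group "sections (I n) V"
      using o(1) by (rule I.comm_group_sections)
    interpret W: comm_group "sections (I n) W"
      using o(2) by (rule I.comm_group_sections)
    interpret Y: comm_group "sections (I n) Y"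
      using oY by (rule I.comm_group_sections)
    interpret VY: group_hom "sections (I n) V" "sections (I n) Y" "restr (I n) V Y"
      using o oY Y by (intro I.group_hom_restr)
    interpret WY: group_hom "sections (I n) W" "sections (I n) Y" "restr (I n) W Y"
      using o oY Y by (intro I.group_hom_restr)
    interpret dV: group_hom "sections (I n) V" "sections (I (Suc n)) V" "d n V"
      using o by (intro group_hom_d)
    interpret dW: group_hom "sections (I n) W" "sections (I (Suc n)) W" "d n W"
      using o by (intro group_hom_d)
    interpret dY: group_hom "sections (I n) Y" "sections (I (Suc n)) Y" "d n Y"
      using oY by (intro group_hom_d)
    let ?v = "restr (I n) V Y" and ?w = "restr (I n) W Y"
    have eq: "d n Y (?v y) = d n Y (?w y')"
      using o oY Y y y' zI oB by (simp add: d_restr I.restr_comp)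
    have "?v y \<otimes>\<^bsub>sections (I n) Y\<^esub> inv\<^bsub>sections (I n) Y\<^esub> ?w y' \<in> Z n Y"
      unfolding Z_iff using y y' eq by simp
    then obtain a b where a: "a \<in> Z n V" and b: "b \<in> Z n W"
      and ab: "?v y \<otimes>\<^bsub>sections (I n) Y\<^esub> inv\<^bsub>sections (I n) Y\<^esub> ?w y' = ?v a \<otimes>\<^bsub>sections (I n) Y\<^esub> ?w b"
      using mv V W VW unfolding mayer_vietoris_def Y_def by meson
    have ab_in: "a \<in> carrier (sections (I n) V)" "b \<in> carrier (sections (I n) W)"
      using a b by (auto simp: Z_iff)
    \<comment> \<open>From y/y' = ab on \<open>Y\<close> follows y/a = y'b there. Since
      \<open>a\<close> and \<open>b\<close> are cocycles, the corrected sections are still preimages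
      of \<open>z\<close>.\<close>
    let ?p = "y \<otimes>\<^bsub>sections (I n) V\<^esub> inv\<^bsub>sections (I n) V\<^esub> a" and ?q = "y' \<otimes>\<^bsub>sections (I n) W\<^esub> b"
    have "?v y = ?v a \<otimes>\<^bsub>sections (I n) Y\<^esub> ?w b \<otimes>\<^bsub>sections (I n) Y\<^esub> ?w y'"
      using ab y(2) y'(2) ab_in by (metis Y.inv_solve_right' VY.hom_closed WY.hom_closed Y.m_closed)
    also have "\<dots> = (?w y' \<otimes>\<^bsub>sections (I n) Y\<^esub> ?w b) \<otimes>\<^bsub>sections (I n) Y\<^esub> ?v a"
      using y'(2) ab_in by (simp add: Y.m_ac)
    finally have "?v y \<otimes>\<^bsub>sections (I n) Y\<^esub> inv\<^bsub>sections (I n) Y\<^esub> ?v a = ?w y' \<otimes>\<^bsub>sections (I n) Y\<^esub> ?w b"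
      using y(2) y'(2) ab_in by (simp add: Y.inv_solve_right')
    then have "?v ?p = ?w ?q"
      using y y' ab_in by simp
    moreover have pq: "?p \<in> carrier (sections (I n) V)" "?q \<in> carrier (sections (I n) W)"
      using y y' ab_in by simp_all
    ultimately obtain c where c: "c \<in> carrier (sections (I n) (V \<union> W))"
      "restr (I n) (V \<union> W) V c = ?p" "restr (I n) (V \<union> W) W c = ?q"
      using I.binary_gluing[OF o(1) pq(1) o(2) pq(2)] by (auto simp: Y_def)
    have "d n (V \<union> W) c = restr (I (Suc n)) B (V \<union> W) z"
    proof (rule I.eq_if_locally_eq[OF o(3)])
      have "d n V ?p = d n V y" "d n W ?q = d n W y'"
        using a b y y' dV.hom_closed[OF y(2)] dW.hom_closed[OF y'(2)] by (simp_all add: Z_iff)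
      then have "restr (I (Suc n)) (V \<union> W) V (d n (V \<union> W) c)
            = restr (I (Suc n)) (V \<union> W) V (restr (I (Suc n)) B (V \<union> W) z)"
          "restr (I (Suc n)) (V \<union> W) W (d n (V \<union> W) c)
            = restr (I (Suc n)) (V \<union> W) W (restr (I (Suc n)) B (V \<union> W) z)"
        using d_restr[of "V \<union> W" V c n] d_restr[of "V \<union> W" W c n] c y y' o oB zI
        by (simp_all add: I.restr_comp)
      then show "\<exists>Y. openin X Y \<and> x \<in> Y \<and> Y \<subseteq> V \<union> W \<and> restr (I (Suc n)) (V \<union> W) Y (d n (V \<union> W) c)
          = restr (I (Suc n)) (V \<union> W) Y (restr (I (Suc n)) B (V \<union> W) z)"
        if "x \<in> V \<union> W" for x
        using that o by blast
    qed (use c o oB y y' zI in \<open>auto simp: d_closed I.restr_closed\<close>)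
    then show "P (V \<union> W)"
      using y y' c by (auto simp: P_def)
  next
    fix x assume "x \<in> B"
    then show "\<exists>V \<in> \<B>. x \<in> V \<and> V \<subseteq> B \<and> P V"
      using Z_locally_d[OF oB z] by (auto simp: P_def)
  qed
  then show ?thesis
    using I.restr_id[OF oB zI] by (simp add: P_def)
qed

text \<open>The cocycle even extends from \<open>V \<inter> W\<close> to \<open>V\<close>, so the
  second factor is 1: lift it to \<open>I n\<close> over the basic set \<open>V \<inter> W\<close>,
  extend the lift by flasqueness, and apply \<open>d n\<close>.\<close>

lemma mayer_vietoris_Suc:
  assumes mv: "mayer_vietoris n"
  shows "mayer_vietoris (Suc n)"
  unfolding mayer_vietoris_def
proof (intro allI impI)
  fix V W z assume V: "V \<in> \<B>" and W: "W \<in> \<B>" and z: "z \<in> Z (Suc n) (V \<inter> W)"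
  note o = basis_open[OF V] basis_open[OF W]
  have Y: "V \<inter> W \<in> \<B>" and oY: "openin X (V \<inter> W)"
    using V W basis_Int basis_open by blast+
  obtain y where y: "y \<in> carrier (sections (I n) (V \<inter> W))" "d n (V \<inter> W) y = z"
    using d_surj[OF mv Y z] by blast
  have "injective_sheaf X (I n)"
    using resolution by (simp add: injective_resolution_def)
  then obtain t where t: "t \<in> carrier (sections (I n) (topspace X))" "restr (I n) (topspace X) (V \<inter> W) t = y"
    using injective_sheaf_flasque[OF _ oY y(1)] by blast
  have oV: "V \<subseteq> topspace X"
    using o openin_subset by blast
  define a where "a = d n V (restr (I n) (topspace X) V t)"
  have a: "a \<in> Z (Suc n) V"
    unfolding a_def using d_in_Z I.restr_closed t o oV by simp
  have az: "restr (I (Suc n)) V (V \<inter> W) a = z"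
    unfolding a_def using t y(2) o oV oY by (simp add: d_restr[symmetric] I.restr_closed I.restr_comp)
  have "\<one>\<^bsub>sections (I (Suc n)) W\<^esub> \<in> Z (Suc n) W"
    using subgroup.one_closed[OF subgroup_Z[OF o(2)]] .
  moreover have "z = restr (I (Suc n)) V (V \<inter> W) a \<otimes>\<^bsub>sections (I (Suc n)) (V \<inter> W)\<^esub>
      restr (I (Suc n)) W (V \<inter> W) \<one>\<^bsub>sections (I (Suc n)) W\<^esub>"
  proof -
    interpret group_hom "sections (I (Suc n)) W" "sections (I (Suc n)) (V \<inter> W)" "restr (I (Suc n)) W (V \<inter> W)"
      using o oY by (intro I.group_hom_restr) auto
    show ?thesis
      using z by (simp add: az Z_iff)
  qed
  ultimately show "\<exists>a \<in> Z (Suc n) V. \<exists>b \<in> Z (Suc n) W. z = restr (I (Suc n)) V (V \<inter> W) a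
      \<otimes>\<^bsub>sections (I (Suc n)) (V \<inter> W)\<^esub> restr (I (Suc n)) W (V \<inter> W) b"
    using a by blast
qed

lemma mayer_vietoris: "mayer_vietoris n"
  by (induction n) (simp_all add: mayer_vietoris_0 mayer_vietoris_Suc)

text \<open>The whole space is basic, so \<open>d_surj\<close> there makes every cocycle of positive
  degree a coboundary, and the cohomology group is a group modulo itself.\<close>

lemma trivial_cohomology:
  assumes "i \<ge> 1"
  shows "trivial_group (cohomology_group X I d i)"
proof -
  obtain n where i: "i = Suc n"
    using assms by (cases i) auto
  let ?T = "topspace X"
  define G where "G = (sections (I i) ?T) \<lparr>carrier := Z i ?T\<rparr>"
  have "d n ?T ` carrier (sections (I n) ?T) = Z i ?T"
    using d_surj[OF mayer_vietoris basis_topspace] d_in_Z[OF openin_topspace] unfolding i by blast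
  then have eq: "cohomology_group X I d i = G Mod carrier G"
    by (simp add: cohomology_group_def cocycles_def coboundaries_def i Z_def[symmetric] G_def)
  have "group (sections (I i) ?T)"
    by (simp add: I.group_sections)
  then interpret G: group G
    unfolding G_def by (rule group.subgroup_imp_group) (simp add: subgroup_Z)
  have "group (G Mod carrier G)"
    by (rule normal.factorgroup_is_group) (rule G.normal_self)
  moreover have "carrier (G Mod carrier G) = {carrier G}"
    using G.coset_join2[OF _ G.subgroup_self] G.one_closed
    by (auto simp: FactGroup_def RCOSETS_def)
  ultimately show ?thesis
    unfolding eq trivial_group_def by (simp add: FactGroup_def)
qed

end


section \<open>Prime ideals of noetherian rings\<close>

locale noetherian_cring = cring R + noetherian_ring R for R (structure)
begin

text \<open>Krull's argument: an ideal maximal among those that contain \<open>J\<close> and avoid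
  all powers of \<open>f\<close> is prime.\<close>

lemma exists_prime_avoiding:
  assumes J: "ideal J R" and f: "f \<in> carrier R" and avoid: "\<And>n::nat. f [^] n \<notin> J"
  obtains P where "P \<in> Spec R" "J \<subseteq> P" "f \<notin> P"
proof -
  define S where "S = {K. ideal K R \<and> J \<subseteq> K \<and> (\<forall>n::nat. f [^] n \<notin> K)}"
  have JS: "J \<in> S"
    using assms by (simp add: S_def)
  have "\<exists>M \<in> S. \<forall>K \<in> S. M \<subseteq> K \<longrightarrow> K = M"
  proof (rule subset_Zorn)
    fix C assume C: "subset.chain S C"
    show "\<exists>U \<in> S. \<forall>K \<in> C. K \<subseteq> U"
    proof (cases "C = {}")
      case False
      have "subset.chain {I. ideal I R} C"
        using C by (auto simp: S_def subset.chain_def)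
      \<comment> \<open>In a noetherian ring a nonempty chain of ideals contains its union, which is
        thus an upper bound within \<open>S\<close>.\<close>
      then have "\<Union>C \<in> C"
        using ideal_chain_is_trivial[OF False] by blast
      then show ?thesis
        using C by (auto simp: subset.chain_def)
    qed (use JS in blast)
  qed
  then obtain M where M: "M \<in> S" and max: "\<And>K. K \<in> S \<Longrightarrow> M \<subseteq> K \<Longrightarrow> K = M"
    by blast
  interpret M: ideal M R
    using M by (simp add: S_def)
  \<comment> \<open>Adding \<open>a\<close> to \<open>M\<close> gives a strictly larger ideal, so by
    maximality it must contain a power of \<open>f\<close>.\<close>
  have power_in: "\<exists>n::nat. \<exists>m \<in> M. \<exists>r \<in> carrier R. f [^] n = m \<oplus> r \<otimes> a" if a: "a \<in> carrier R" "a \<notin> M" for a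
  proof -
    have sub: "M \<subseteq> M <+>\<^bsub>R\<^esub> PIdl a"
    proof
      fix m assume m: "m \<in> M"
      have "\<zero> \<in> PIdl a"
        using a additive_subgroup.zero_closed[OF ideal.axioms(1)[OF cgenideal_ideal]] by blast
      then have "m \<oplus> \<zero> \<in> M <+>\<^bsub>R\<^esub> PIdl a"
        using m unfolding set_add_def' by blast
      then show "m \<in> M <+>\<^bsub>R\<^esub> PIdl a"
        using m M.a_subset by auto
    qed
    have "\<zero> \<oplus> a \<in> M <+>\<^bsub>R\<^esub> PIdl a"
      using cgenideal_self[OF a(1)] M.zero_closed unfolding set_add_def' by blast
    then have "M <+>\<^bsub>R\<^esub> PIdl a \<notin> S"
      using max[OF _ sub] a by auto
    moreover have "ideal (M <+>\<^bsub>R\<^esub> PIdl a) R"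
      using a by (intro add_ideals M.is_ideal cgenideal_ideal)
    moreover have "J \<subseteq> M <+>\<^bsub>R\<^esub> PIdl a"
      using M sub by (auto simp: S_def)
    ultimately obtain n :: nat where "f [^] n \<in> M <+>\<^bsub>R\<^esub> PIdl a"
      by (auto simp: S_def)
    then show ?thesis
      unfolding set_add_def' cgenideal_def by blast
  qed
  have "primeideal M R"
  proof (rule primeidealI)
    show "carrier R \<noteq> M"
      using M f by (auto simp: S_def)
    fix a b assume ab: "a \<in> carrier R" "b \<in> carrier R" "a \<otimes> b \<in> M"
    show "a \<in> M \<or> b \<in> M"
    proof (rule ccontr)
      assume "\<not> (a \<in> M \<or> b \<in> M)"
      then obtain n k :: nat and m r m' r' where *: "m \<in> M" "r \<in> carrier R" "f [^] n = m \<oplus> r \<otimes> a"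
          "m' \<in> M" "r' \<in> carrier R" "f [^] k = m' \<oplus> r' \<otimes> b"
        using power_in ab by meson
      then have carr: "m \<in> carrier R" "m' \<in> carrier R"
        using M.a_subset by auto
      have "f [^] (n + k) = (m \<oplus> r \<otimes> a) \<otimes> (m' \<oplus> r' \<otimes> b)"
        using f * by (simp flip: nat_pow_mult)
      \<comment> \<open>Each summand now has one of the factors m, m' and
        \<open>a \<otimes> b\<close>, all of which lie in \<open>M\<close>.\<close>
      also have "\<dots> = m \<otimes> (m' \<oplus> r' \<otimes> b) \<oplus> ((r \<otimes> a) \<otimes> m' \<oplus> (r \<otimes> r') \<otimes> (a \<otimes> b))"
        using carr ab * by algebra
      also have "\<dots> \<in> M"
        using carr ab * by (intro M.a_closed M.I_r_closed[OF *(1)] M.I_l_closed[OF *(4)] M.I_l_closed[OF ab(3)]) auto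
      finally show False
        using M by (simp add: S_def)
    qed
  qed (simp_all add: M.is_ideal is_cring)
  moreover have "f \<notin> M"
    using M f by (auto simp: S_def dest: spec[of _ "1::nat"])
  ultimately show ?thesis
    using that M by (auto simp: S_def Spec_def)
qed

text \<open>The bridge from geometry to algebra: conditions checked prime by prime become an
  equation in R for some power of \<open>f\<close>.\<close>

lemma power_in_ideal:
  assumes "ideal J R" "f \<in> carrier R" "\<And>P. \<lbrakk>P \<in> Spec R; J \<subseteq> P\<rbrakk> \<Longrightarrow> f \<in> P"
  obtains n :: nat where "f [^] n \<in> J"
  using assms exists_prime_avoiding by metis

section \<open>Basic open sets of the spectrum\<close>

definition D :: "'a \<Rightarrow> 'a set set" where
  "D f = {P \<in> Spec R. f \<notin> P}"

lemma in_D: "P \<in> D f \<longleftrightarrow> primeideal P R \<and> f \<notin> P"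
  by (simp add: D_def Spec_def)

lemma prime_mult_iff:
  "\<lbrakk>primeideal P R; a \<in> carrier R; b \<in> carrier R\<rbrakk> \<Longrightarrow> a \<otimes> b \<in> P \<longleftrightarrow> a \<in> P \<or> b \<in> P"
  by (meson ideal.I_l_closed ideal.I_r_closed primeideal.I_prime primeideal.axioms(1))

lemma one_notin_prime: "primeideal P R \<Longrightarrow> \<one> \<notin> P"
  by (metis ideal.one_imp_carrier primeideal.I_notcarr primeideal.axioms(1))

lemma zero_in_prime: "primeideal P R \<Longrightarrow> \<zero> \<in> P"
  by (meson additive_subgroup.zero_closed ideal.axioms(1) primeideal.axioms(1))

lemma prime_add_closed: "\<lbrakk>primeideal P R; a \<in> P; b \<in> P\<rbrakk> \<Longrightarrow> a \<oplus> b \<in> P"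
  by (meson additive_subgroup.a_closed ideal.axioms(1) primeideal.axioms(1))

lemma prime_pow_notin:
  assumes "primeideal P R" "a \<in> carrier R" "a \<notin> P"
  shows "a [^] (n::nat) \<notin> P"
  using assms by (induction n) (simp_all add: one_notin_prime prime_mult_iff)

lemma prime_pow_in:
  assumes "primeideal P R" "a \<in> carrier R" "a [^] (n::nat) \<in> P"
  shows "a \<in> P"
  using assms prime_pow_notin by blast

lemma D_mult: "\<lbrakk>a \<in> carrier R; b \<in> carrier R\<rbrakk> \<Longrightarrow> D (a \<otimes> b) = D a \<inter> D b"
  by (auto simp: in_D prime_mult_iff)

lemma D_one: "D \<one> = Spec R"
  by (auto simp: D_def Spec_def one_notin_prime)

lemma D_zero: "D \<zero> = {}"
  by (auto simp: in_D zero_in_prime)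

lemma D_pow: "a \<in> carrier R \<Longrightarrow> D a \<subseteq> D (a [^] (n::nat))"
  by (auto simp: in_D prime_pow_notin)

lemma openin_D: "f \<in> carrier R \<Longrightarrow> openin (zariski R) (D f)"
  unfolding openin_zariski zariski_open_def D_def by (intro exI[of _ "{f}"]) auto

lemma openin_zariski_prime: "openin (zariski R) U \<Longrightarrow> P \<in> U \<Longrightarrow> primeideal P R"
  by (auto simp: openin_zariski zariski_open_def Spec_def)

lemma topspace_zariski: "topspace (zariski R) = Spec R"
proof
  show "topspace (zariski R) \<subseteq> Spec R"
    using openin_zariski_prime[OF openin_topspace] by (auto simp: Spec_def)
  show "Spec R \<subseteq> topspace (zariski R)"
    using openin_subset[OF openin_D[of \<one>]] by (simp add: D_one)
qed

lemma D_nbhd: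
  assumes "openin (zariski R) U" "P \<in> U"
  obtains f where "f \<in> carrier R" "P \<in> D f" "D f \<subseteq> U"
proof -
  obtain E where E: "E \<subseteq> carrier R" "U = {P \<in> Spec R. \<not> E \<subseteq> P}"
    using assms by (auto simp: openin_zariski zariski_open_def)
  then obtain f where "f \<in> E" "f \<notin> P"
    using assms by blast
  then show ?thesis
    using that[of f] E assms by (auto simp: D_def)
qed

text \<open>\<open>f\<close> lies in the radical of the ideal generated by \<open>t\<close>. A
  denominator \<open>t\<close> can thus be traded for a power of \<open>f\<close>.\<close>

lemma D_subset_D:
  assumes "D f \<subseteq> D t" "f \<in> carrier R" "t \<in> carrier R"
  obtains n :: nat and c where "c \<in> carrier R" "f [^] n = c \<otimes> t"
proof -
  have "f \<in> P" if "P \<in> Spec R" "PIdl t \<subseteq> P" for P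
    using assms that cgenideal_self[of t] by (auto simp: D_def)
  then obtain n :: nat where "f [^] n \<in> PIdl t"
    using power_in_ideal[OF cgenideal_ideal[OF assms(3)] assms(2)] by blast
  then show ?thesis
    using that by (auto simp: cgenideal_def)
qed

text \<open>Every prime containing \<open>f\<close> and \<open>g\<close> contains \<open>h\<close>.
  The equation is a partition of unity once \<open>h\<close> is inverted.\<close>

lemma D_subset_Un:
  assumes "D h \<subseteq> D f \<union> D g" "h \<in> carrier R" "f \<in> carrier R" "g \<in> carrier R"
  obtains n :: nat and a b where "a \<in> carrier R" "b \<in> carrier R" "h [^] n = a \<otimes> f \<oplus> b \<otimes> g"
proof -
  define J where "J = PIdl f <+>\<^bsub>R\<^esub> PIdl g"
  have J: "ideal J R"
    unfolding J_def using assms by (intro add_ideals cgenideal_ideal)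
  have "\<one> \<otimes> f \<oplus> \<zero> \<otimes> g \<in> J" "\<zero> \<otimes> f \<oplus> \<one> \<otimes> g \<in> J"
    unfolding J_def set_add_def' cgenideal_def by blast+
  then have "f \<in> J" "g \<in> J"
    using assms by simp_all
  then have "h \<in> P" if "P \<in> Spec R" "J \<subseteq> P" for P
    using assms(1) that by (auto simp: D_def)
  then obtain n :: nat where "h [^] n \<in> J"
    using power_in_ideal[OF J assms(2)] by blast
  then show ?thesis
    using that unfolding J_def set_add_def' cgenideal_def by blast
qed

text \<open>An element that vanishes in all local rings over \<open>D h\<close> vanishes in R_h: no
  prime in \<open>D h\<close> contains its annihilator, so a power of \<open>h\<close> lies in the
  annihilator.\<close>

lemma annihilator_power:
  assumes h: "h \<in> carrier R" and x: "x \<in> carrier R"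
    and loc: "\<And>P. P \<in> D h \<Longrightarrow> \<exists>t \<in> carrier R - P. t \<otimes> x = \<zero>"
  obtains n :: nat where "h [^] n \<otimes> x = \<zero>"
proof -
  define J where "J = {t \<in> carrier R. t \<otimes> x = \<zero>}"
  have "ideal J R"
  proof (rule idealI)
    show "subgroup J (add_monoid R)"
      using x by (intro add.subgroupI) (auto simp: J_def l_distr l_minus simp flip: a_inv_def)
    show ta: "t \<otimes> a \<in> J" if "t \<in> J" "a \<in> carrier R" for t a
    proof -
      have "(t \<otimes> a) \<otimes> x = a \<otimes> (t \<otimes> x)"
        using that x by (simp add: J_def m_ac)
      then show ?thesis
        using that by (simp add: J_def)
    qed
    show "a \<otimes> t \<in> J" if "t \<in> J" "a \<in> carrier R" for t a
      using ta[OF that] that by (simp add: J_def m_comm)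
  qed (rule ring_axioms)
  moreover have "h \<in> P" if "P \<in> Spec R" "J \<subseteq> P" for P
    using loc[of P] that by (auto simp: J_def D_def)
  ultimately show ?thesis
    using power_in_ideal[OF _ h] that unfolding J_def by blast
qed

section \<open>The nilradical as the intersection of all primes\<close>

lemma nilradical_iff: "r \<in> nilradical R \<longleftrightarrow> r \<in> carrier R \<and> (\<forall>P. primeideal P R \<longrightarrow> r \<in> P)"
proof
  assume "r \<in> nilradical R"
  then obtain n :: nat where "r \<in> carrier R" "r [^] n = \<zero>"
    by (auto simp: nilradical_def)
  then show "r \<in> carrier R \<and> (\<forall>P. primeideal P R \<longrightarrow> r \<in> P)"
    using prime_pow_in zero_in_prime by metis
next
  assume r: "r \<in> carrier R \<and> (\<forall>P. primeideal P R \<longrightarrow> r \<in> P)"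
  then obtain n :: nat where "r [^] n \<in> {\<zero>}"
    using power_in_ideal[OF zeroideal, of r] by (auto simp: Spec_def)
  then show "r \<in> nilradical R"
    using r by (auto simp: nilradical_def)
qed

lemma nilradical_closed: "r \<in> nilradical R \<Longrightarrow> r \<in> carrier R"
  by (simp add: nilradical_iff)

lemma nilradical_zero: "\<zero> \<in> nilradical R"
  by (simp add: nilradical_iff zero_in_prime)

lemma nilradical_add: "\<lbrakk>a \<in> nilradical R; b \<in> nilradical R\<rbrakk> \<Longrightarrow> a \<oplus> b \<in> nilradical R"
  by (simp add: nilradical_iff prime_add_closed)

lemma nilradical_mult:
  "\<lbrakk>a \<in> carrier R; b \<in> nilradical R\<rbrakk> \<Longrightarrow> a \<otimes> b \<in> nilradical R"
  "\<lbrakk>a \<in> carrier R; b \<in> nilradical R\<rbrakk> \<Longrightarrow> b \<otimes> a \<in> nilradical R"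
  by (simp_all add: nilradical_iff prime_mult_iff)

text \<open>Adding a nilpotent to a denominator leaves a denominator; in \<open>frac_split\<close>
  this allows division by the unipotent factors.\<close>

lemma add_nil_notin:
  assumes "primeideal P R" "f \<in> carrier R" "f \<notin> P" "r \<in> nilradical R"
  shows "f \<oplus> r \<notin> P"
proof
  assume "f \<oplus> r \<in> P"
  moreover have r: "r \<in> carrier R" "r \<in> P"
    using assms by (auto simp: nilradical_iff)
  moreover have "\<ominus> r \<in> P"
    using assms r by (meson additive_subgroup.a_inv_closed ideal.axioms(1) primeideal.axioms(1))
  moreover have "(f \<oplus> r) \<oplus> \<ominus> r = f"
    using assms r by (simp add: a_assoc r_neg)
  ultimately show False
    using prime_add_closed[OF assms(1), of "f \<oplus> r" "\<ominus> r"] assms(3) by metis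
qed

text \<open>The elements \<open>f\<close> such that \<open>\<Phi>\<close> holds for \<open>D f\<close> form an ideal, since \<open>D (f \<oplus> g)\<close> is covered by
  \<open>D (f \<otimes> (f \<oplus> g))\<close> and \<open>D (g \<otimes> (f \<oplus> g))\<close>. As \<open>\<Phi>\<close> holds locally on \<open>D h\<close>, every prime ideal containing
  this ideal contains \<open>h\<close>, so a power of \<open>h\<close> lies in it.\<close>

lemma D_cover_induct:
  assumes h: "h \<in> carrier R" and empty: "\<Phi> {}"
    and mono: "\<And>V W. \<lbrakk>V \<in> D ` carrier R; W \<in> D ` carrier R; W \<subseteq> V; \<Phi> V\<rbrakk> \<Longrightarrow> \<Phi> W"
    and Un: "\<And>V W. \<lbrakk>V \<in> D ` carrier R; W \<in> D ` carrier R; V \<union> W \<in> D ` carrier R; \<Phi> V; \<Phi> W\<rbrakk> \<Longrightarrow> \<Phi> (V \<union> W)"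
    and loc: "\<And>P. P \<in> D h \<Longrightarrow> \<exists>V \<in> D ` carrier R. P \<in> V \<and> V \<subseteq> D h \<and> \<Phi> V"
  shows "\<Phi> (D h)"
proof -
  define J where "J = {f \<in> carrier R. \<Phi> (D f)}"
  have mult: "a \<otimes> f \<in> J" if "f \<in> J" "a \<in> carrier R" for a f
  proof -
    have "D (a \<otimes> f) \<subseteq> D f"
      using that by (auto simp: J_def D_mult)
    then show ?thesis
      using that mono[of "D f" "D (a \<otimes> f)"] by (auto simp: J_def)
  qed
  have add: "f \<oplus> g \<in> J" if "f \<in> J" "g \<in> J" for f g
  proof -
    have carr: "f \<in> carrier R" "g \<in> carrier R"
      using that by (auto simp: J_def)
    have "D (f \<oplus> g) \<subseteq> D f \<union> D g"
      by (auto simp: in_D prime_add_closed)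
    then have "D (f \<oplus> g) = D ((f \<oplus> g) \<otimes> f) \<union> D ((f \<oplus> g) \<otimes> g)"
      using carr by (auto simp: D_mult)
    then show ?thesis
      using Un[of "D ((f \<oplus> g) \<otimes> f)" "D ((f \<oplus> g) \<otimes> g)"] mult[OF that(1), of "f \<oplus> g"]
        mult[OF that(2), of "f \<oplus> g"] carr by (auto simp: J_def)
  qed
  have "ideal J R"
  proof (rule idealI)
    show "subgroup J (add_monoid R)"
    proof (rule add.subgroupI)
      show "J \<noteq> {}"
        using empty D_zero by (auto simp: J_def intro!: exI[of _ \<zero>])
      show "\<ominus> f \<in> J" if "f \<in> J" for f
        using mult[OF that, of "\<ominus> \<one>"] that by (simp add: J_def l_minus)
    qed (use add in \<open>auto simp: J_def\<close>)
    show "f \<otimes> a \<in> J" if "f \<in> J" "a \<in> carrier R" for f a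
      using mult[OF that] that by (simp add: J_def m_comm)
  qed (use mult ring_axioms in auto)
  moreover have "h \<in> P" if P: "P \<in> Spec R" "J \<subseteq> P" for P
  proof (rule ccontr)
    assume "h \<notin> P"
    then obtain f where "f \<in> carrier R" "P \<in> D f" "\<Phi> (D f)"
      using loc[of P] P by (auto simp: D_def)
    then show False
      using P by (auto simp: J_def D_def)
  qed
  ultimately obtain n :: nat where n: "h [^] n \<in> J"
    using power_in_ideal[OF _ h] by blast
  then show ?thesis
    \<comment> \<open>The inclusion of \<open>D h\<close> in \<open>D (h [^] n)\<close> also covers
      n = 0, where the larger set is the whole spectrum.\<close>
    using mono[of "D (h [^] n)" "D h"] D_pow[OF h, of n] h by (auto simp: J_def)
qed


section \<open>Fractions in the local rings\<close>

abbreviation frac :: "'a set \<Rightarrow> 'a \<Rightarrow> 'a \<Rightarrow> ('a \<times> 'a) set" where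
  "frac P \<equiv> loc_frac R (carrier R - P)"

context
  fixes P
  assumes P: "primeideal P R"
begin

lemma equiv_loc_rel: "equiv (carrier R \<times> (carrier R - P)) (loc_rel R (carrier R - P))"
proof (rule equivI)
  let ?S = "carrier R - P"
  show "loc_rel R ?S \<subseteq> (carrier R \<times> ?S) \<times> carrier R \<times> ?S"
    by (auto simp: loc_rel_def)
  show "refl_on (carrier R \<times> ?S) (loc_rel R ?S)"
    using one_notin_prime[OF P] by (auto simp: refl_on_def loc_rel_def)
  show "sym (loc_rel R ?S)"
    unfolding sym_def loc_rel_def by auto (metis DiffI)
  show "trans (loc_rel R ?S)"
  proof (rule transI)
    fix x y z assume xy: "(x, y) \<in> loc_rel R ?S" and yz: "(y, z) \<in> loc_rel R ?S"
    obtain r s r' s' r'' s'' where xyz: "x = (r, s)" "y = (r', s')" "z = (r'', s'')"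
      by (metis prod.exhaust)
    obtain t u where t: "t \<in> ?S" "t \<otimes> (r \<otimes> s') = t \<otimes> (r' \<otimes> s)"
      and u: "u \<in> ?S" "u \<otimes> (r' \<otimes> s'') = u \<otimes> (r'' \<otimes> s')"
      using xy yz by (auto simp: xyz loc_rel_def)
    have carr: "r \<in> carrier R" "r' \<in> carrier R" "r'' \<in> carrier R" "s \<in> ?S" "s' \<in> ?S" "s'' \<in> ?S"
      using xy yz by (auto simp: xyz loc_rel_def)
    \<comment> \<open>The witness combines the two given ones with the middle denominator s',
      through which both relations pass.\<close>
    have "(t \<otimes> (u \<otimes> s')) \<otimes> (r \<otimes> s'') = (u \<otimes> s'') \<otimes> (t \<otimes> (r \<otimes> s'))"
      using carr t(1) u(1) by (simp add: m_ac)
    also have "\<dots> = (t \<otimes> s) \<otimes> (u \<otimes> (r' \<otimes> s''))"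
      unfolding t(2) using carr t(1) u(1) by (simp add: m_ac)
    also have "\<dots> = (t \<otimes> (u \<otimes> s')) \<otimes> (r'' \<otimes> s)"
      unfolding u(2) using carr t(1) u(1) by (simp add: m_ac)
    finally show "(x, z) \<in> loc_rel R ?S"
      using carr t(1) u(1) by (auto simp: xyz loc_rel_def prime_mult_iff[OF P] intro!: bexI[of _ "t \<otimes> (u \<otimes> s')"])
  qed
qed

lemma frac_eq_iff:
  assumes "r \<in> carrier R" "s \<in> carrier R - P" "r' \<in> carrier R" "s' \<in> carrier R - P"
  shows "frac P r s = frac P r' s' \<longleftrightarrow> (\<exists>t \<in> carrier R - P. t \<otimes> (r \<otimes> s') = t \<otimes> (r' \<otimes> s))"
  using eq_equiv_class_iff[OF equiv_loc_rel, of "(r, s)" "(r', s')"] assms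
  by (simp add: loc_frac_def loc_rel_def)

lemma frac_eqI:
  assumes "r \<in> carrier R" "s \<in> carrier R - P" "r' \<in> carrier R" "s' \<in> carrier R - P" "r \<otimes> s' = r' \<otimes> s"
  shows "frac P r s = frac P r' s'"
  using assms one_notin_prime[OF P] by (auto simp: frac_eq_iff intro!: bexI[of _ \<one>])

lemma frac_self: "\<lbrakk>r \<in> carrier R; s \<in> carrier R - P\<rbrakk> \<Longrightarrow> (r, s) \<in> frac P r s"
  using equiv_class_self[OF equiv_loc_rel] by (simp add: loc_frac_def)

lemma in_frac:
  assumes "(a, b) \<in> frac P r s"
  shows "a \<in> carrier R" "b \<in> carrier R - P" "\<exists>t \<in> carrier R - P. t \<otimes> (r \<otimes> b) = t \<otimes> (a \<otimes> s)"
  using assms by (auto simp: loc_frac_def loc_rel_def)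

lemma frac_closed: "\<lbrakk>r \<in> carrier R; s \<in> carrier R - P\<rbrakk> \<Longrightarrow> frac P r s \<in> carrier (stalk R P)"
  by (auto simp: localization_def loc_frac_def intro: quotientI)

text \<open>The operations of \<open>localization\<close> are unions over all representatives.
  Independence of the representatives and nonemptiness of the classes collapse such a union to one
  value.\<close>

lemma UN_frac_const:
  assumes "r \<in> carrier R" "s \<in> carrier R - P" "r' \<in> carrier R" "s' \<in> carrier R - P"
    and "\<And>a b a' b'. \<lbrakk>(a, b) \<in> frac P r s; (a', b') \<in> frac P r' s'\<rbrakk> \<Longrightarrow> f a b a' b' = f r s r' s'"
  shows "(\<Union>(a, b) \<in> frac P r s. \<Union>(a', b') \<in> frac P r' s'. f a b a' b') = f r s r' s'"
proof -
  have "(\<Union>(a, b) \<in> frac P r s. \<Union>(a', b') \<in> frac P r' s'. f a b a' b')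
      = (\<Union>(a, b) \<in> frac P r s. \<Union>(a', b') \<in> frac P r' s'. f r s r' s')"
    using assms(5) by (intro SUP_cong refl) (auto split: prod.splits)
  then show ?thesis
    using frac_self[OF assms(1,2)] frac_self[OF assms(3,4)] by auto
qed

lemma frac_mult:
  assumes carr: "r \<in> carrier R" "s \<in> carrier R - P" "r' \<in> carrier R" "s' \<in> carrier R - P"
  shows "frac P r s \<otimes>\<^bsub>stalk R P\<^esub> frac P r' s' = frac P (r \<otimes> r') (s \<otimes> s')"
proof -
  have "frac P (a \<otimes> a') (b \<otimes> b') = frac P (r \<otimes> r') (s \<otimes> s')"
    if ab: "(a, b) \<in> frac P r s" "(a', b') \<in> frac P r' s'" for a b a' b'
  proof -
    note c = in_frac(1,2)[OF ab(1)] in_frac(1,2)[OF ab(2)]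
    obtain t u where t: "t \<in> carrier R - P" "t \<otimes> (r \<otimes> b) = t \<otimes> (a \<otimes> s)"
      and u: "u \<in> carrier R - P" "u \<otimes> (r' \<otimes> b') = u \<otimes> (a' \<otimes> s')"
      using in_frac(3)[OF ab(1)] in_frac(3)[OF ab(2)] by blast
    have "(t \<otimes> u) \<otimes> ((a \<otimes> a') \<otimes> (s \<otimes> s')) = (t \<otimes> (a \<otimes> s)) \<otimes> (u \<otimes> (a' \<otimes> s'))"
      using carr c t(1) u(1) by (simp add: m_ac)
    also have "\<dots> = (t \<otimes> u) \<otimes> ((r \<otimes> r') \<otimes> (b \<otimes> b'))"
      unfolding t(2)[symmetric] u(2)[symmetric] using carr c t(1) u(1) by (simp add: m_ac)
    finally show ?thesis
      using carr c t(1) u(1) by (subst frac_eq_iff) (auto simp: prime_mult_iff[OF P] intro!: bexI[of _ "t \<otimes> u"])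
  qed
  from UN_frac_const[OF carr, of "\<lambda>a b a' b'. frac P (a \<otimes> a') (b \<otimes> b')", OF this]
  show ?thesis
    by (simp add: localization_def)
qed

lemma frac_add:
  assumes carr: "r \<in> carrier R" "s \<in> carrier R - P" "r' \<in> carrier R" "s' \<in> carrier R - P"
  shows "frac P r s \<oplus>\<^bsub>stalk R P\<^esub> frac P r' s' = frac P (r \<otimes> s' \<oplus> r' \<otimes> s) (s \<otimes> s')"
proof -
  have "frac P (a \<otimes> b' \<oplus> a' \<otimes> b) (b \<otimes> b') = frac P (r \<otimes> s' \<oplus> r' \<otimes> s) (s \<otimes> s')"
    if ab: "(a, b) \<in> frac P r s" "(a', b') \<in> frac P r' s'" for a b a' b'
  proof -
    note c = in_frac(1,2)[OF ab(1)] in_frac(1,2)[OF ab(2)]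
    obtain t u where t: "t \<in> carrier R - P" "t \<otimes> (r \<otimes> b) = t \<otimes> (a \<otimes> s)"
      and u: "u \<in> carrier R - P" "u \<otimes> (r' \<otimes> b') = u \<otimes> (a' \<otimes> s')"
      using in_frac(3)[OF ab(1)] in_frac(3)[OF ab(2)] by blast
    have "(t \<otimes> u) \<otimes> ((a \<otimes> b' \<oplus> a' \<otimes> b) \<otimes> (s \<otimes> s'))
        = (u \<otimes> b' \<otimes> s') \<otimes> (t \<otimes> (a \<otimes> s)) \<oplus> (t \<otimes> b \<otimes> s) \<otimes> (u \<otimes> (a' \<otimes> s'))"
      using carr c t(1) u(1) by (simp add: m_ac r_distr l_distr)
    also have "\<dots> = (t \<otimes> u) \<otimes> ((r \<otimes> s' \<oplus> r' \<otimes> s) \<otimes> (b \<otimes> b'))"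
      unfolding t(2)[symmetric] u(2)[symmetric] using carr c t(1) u(1) by (simp add: m_ac r_distr l_distr)
    finally show ?thesis
      using carr c t(1) u(1) by (subst frac_eq_iff) (auto simp: prime_mult_iff[OF P] intro!: bexI[of _ "t \<otimes> u"])
  qed
  from UN_frac_const[OF carr, of "\<lambda>a b a' b'. frac P (a \<otimes> b' \<oplus> a' \<otimes> b) (b \<otimes> b')", OF this]
  show ?thesis
    by (simp add: localization_def)
qed

lemma stalk_one: "\<one>\<^bsub>stalk R P\<^esub> = frac P \<one> \<one>"
  by (simp add: localization_def)

lemma stalk_zero: "\<zero>\<^bsub>stalk R P\<^esub> = frac P \<zero> \<one>"
  by (simp add: localization_def)

lemma one_plus_frac:
  "\<lbrakk>r \<in> carrier R; s \<in> carrier R - P\<rbrakk> \<Longrightarrow> \<one>\<^bsub>stalk R P\<^esub> \<oplus>\<^bsub>stalk R P\<^esub> frac P r s = frac P (s \<oplus> r) s"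
  using one_notin_prime[OF P] by (simp add: stalk_one frac_add)

lemma frac_pow:
  assumes "r \<in> carrier R" "s \<in> carrier R - P"
  shows "frac P r s [^]\<^bsub>stalk R P\<^esub> (n::nat) = frac P (r [^] n) (s [^] n)"
proof (induction n)
  case 0
  show ?case
    by (simp add: nat_pow_def stalk_one)
next
  case (Suc n)
  have "frac P r s [^]\<^bsub>stalk R P\<^esub> (Suc n) = frac P (r [^] n) (s [^] n) \<otimes>\<^bsub>stalk R P\<^esub> frac P r s"
    using Suc by (simp add: nat_pow_def)
  then show ?case
    using assms prime_pow_notin[OF P] by (simp add: frac_mult)
qed

lemma frac_eq_zero_iff:
  assumes "r \<in> carrier R" "s \<in> carrier R - P"
  shows "frac P r s = \<zero>\<^bsub>stalk R P\<^esub> \<longleftrightarrow> (\<exists>t \<in> carrier R - P. t \<otimes> r = \<zero>)"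
  using assms one_notin_prime[OF P] by (auto simp: stalk_zero frac_eq_iff)

end

end


section \<open>Sections of the sheaf of unipotent units\<close>

context noetherian_cring
begin

lemma basis_D: "binary_cover_basis (zariski R) (D ` carrier R)"
proof
  show "B \<inter> B' \<in> D ` carrier R" if "B \<in> D ` carrier R" "B' \<in> D ` carrier R" for B B'
    using that by (auto simp flip: D_mult)
  show "topspace (zariski R) \<in> D ` carrier R"
    using D_one by (auto simp: topspace_zariski)
  show "\<exists>B \<in> D ` carrier R. P \<in> B \<and> B \<subseteq> U" if "openin (zariski R) U" "P \<in> U" for U P
    by (rule D_nbhd[OF that]) auto
next
  fix B \<Phi>
  assume B: "B \<in> D ` carrier R" and *: "\<Phi> {}"
    "\<And>V W. \<lbrakk>V \<in> D ` carrier R; W \<in> D ` carrier R; W \<subseteq> V; \<Phi> V\<rbrakk> \<Longrightarrow> \<Phi> W"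
    "\<And>V W. \<lbrakk>V \<in> D ` carrier R; W \<in> D ` carrier R; V \<union> W \<in> D ` carrier R; \<Phi> V; \<Phi> W\<rbrakk> \<Longrightarrow> \<Phi> (V \<union> W)"
    "\<And>P. P \<in> B \<Longrightarrow> \<exists>V \<in> D ` carrier R. P \<in> V \<and> V \<subseteq> B \<and> \<Phi> V"
  from B obtain h where "h \<in> carrier R" "B = D h"
    by blast
  with * show "\<Phi> B"
    using D_cover_induct[of h \<Phi>] by blast
qed (auto simp: openin_D)

abbreviation F :: "('a set, 'a set \<Rightarrow> ('a \<times> 'a) set) presheaf" where
  "F \<equiv> one_plus_N R"

text \<open>This is 1 + r/f as a single fraction, valid on all of \<open>U\<close>. Nilpotence of
  \<open>r\<close> in R, not just in the local rings, gives one exponent for all points.\<close>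

definition unipotent_frac :: "'a set set \<Rightarrow> 'a \<Rightarrow> 'a \<Rightarrow> ('a set \<Rightarrow> ('a \<times> 'a) set) \<Rightarrow> bool" where
  "unipotent_frac U f r s \<longleftrightarrow> f \<in> carrier R \<and> r \<in> nilradical R \<and>
    (\<forall>P \<in> U. f \<notin> P \<and> s P = frac P (f \<oplus> r) f)"

lemma unipotent_frac_subset: "\<lbrakk>unipotent_frac U f r s; V \<subseteq> U\<rbrakk> \<Longrightarrow> unipotent_frac V f r s"
  by (auto simp: unipotent_frac_def)

lemma unipotent_frac_cong:
  "\<lbrakk>unipotent_frac U f r s; \<And>P. P \<in> U \<Longrightarrow> s P = s' P\<rbrakk> \<Longrightarrow> unipotent_frac U f r s'"
  by (auto simp: unipotent_frac_def)

lemma structure_ring_pow: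
  "P \<in> U \<Longrightarrow> (x [^]\<^bsub>structure_ring R U\<^esub> (n::nat)) P = x P [^]\<^bsub>stalk R P\<^esub> n"
  by (induction n) (simp_all add: nat_pow_def structure_ring_def)

lemma sections_F: "carrier (sections F U) =
    (\<lambda>x. \<one>\<^bsub>structure_ring R U\<^esub> \<oplus>\<^bsub>structure_ring R U\<^esub> x) ` nilradical (structure_ring R U)"
  by (auto simp: one_plus_N_def unipotent_units_def)

lemma one_plus_apply:
  "P \<in> U \<Longrightarrow> (\<one>\<^bsub>structure_ring R U\<^esub> \<oplus>\<^bsub>structure_ring R U\<^esub> x) P = \<one>\<^bsub>stalk R P\<^esub> \<oplus>\<^bsub>stalk R P\<^esub> x P"
  by (simp add: structure_ring_def)

lemma F_extensional: "s \<in> carrier (sections F U) \<Longrightarrow> s \<in> extensional U"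
  by (auto simp: sections_F structure_ring_def)

text \<open>If (r/f)^n vanishes at \<open>P\<close>, some t outside \<open>P\<close> kills r^n.
  Expanding the fraction by t makes the numerator nilpotent in R, at the price of shrinking to a set
  where t is invertible.\<close>

lemma F_local:
  assumes U: "openin (zariski R) U" and s: "s \<in> carrier (sections F U)" and P: "P \<in> U"
  obtains h f r where "h \<in> carrier R" "P \<in> D h" "D h \<subseteq> U" "unipotent_frac (D h) f r s"
proof -
  obtain x n where x: "x \<in> carrier (structure_ring R U)" "x [^]\<^bsub>structure_ring R U\<^esub> (n::nat) = \<zero>\<^bsub>structure_ring R U\<^esub>"
    and s_eq: "s = \<one>\<^bsub>structure_ring R U\<^esub> \<oplus>\<^bsub>structure_ring R U\<^esub> x"
    using s by (auto simp: sections_F nilradical_def)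
  obtain V r f where V: "openin (zariski R) V" "P \<in> V" "V \<subseteq> U" and rf: "r \<in> carrier R" "f \<in> carrier R"
    and x_eq: "\<And>Q. Q \<in> V \<Longrightarrow> f \<notin> Q \<and> x Q = frac Q r f"
    using x(1) P unfolding structure_ring_def by auto
  have prime: "primeideal Q R" if "Q \<in> V" for Q
    using openin_zariski_prime[OF V(1) that] .
  have "frac P (r [^] n) (f [^] n) = \<zero>\<^bsub>stalk R P\<^esub>"
    using frac_pow[OF prime[OF V(2)], of r f n] structure_ring_pow[OF P, of x n] x(2) x_eq[OF V(2)] rf P
    by (simp add: structure_ring_def)
  then obtain t where t: "t \<in> carrier R" "t \<notin> P" "t \<otimes> r [^] n = \<zero>"
    using frac_eq_zero_iff[OF prime[OF V(2)], of "r [^] n" "f [^] n"] rf x_eq[OF V(2)]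
      prime_pow_notin[OF prime[OF V(2)]] by auto
  obtain h where h: "h \<in> carrier R" "P \<in> D h" "D h \<subseteq> V"
    using D_nbhd[OF V(1,2)] by blast
  \<comment> \<open>The exponent n + 1 leaves a full factor t beside r^n even for n = 0.\<close>
  have "(t \<otimes> r) [^] Suc n = (t [^] n \<otimes> r) \<otimes> (t \<otimes> r [^] n)"
    using t(1) rf by (simp add: nat_pow_distrib m_ac)
  then have "t \<otimes> r \<in> nilradical R"
    using t rf unfolding nilradical_def by (auto intro!: exI[of _ "Suc n"] simp del: nat_pow_Suc)
  moreover have "t \<otimes> f \<notin> Q \<and> s Q = frac Q (t \<otimes> f \<oplus> t \<otimes> r) (t \<otimes> f)" if Q: "Q \<in> D (h \<otimes> t)" for Q
  proof -
    have Qp: "primeideal Q R" "t \<notin> Q" and QV: "Q \<in> V"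
      using Q h t by (auto simp: D_mult in_D)
    have "s Q = frac Q (f \<oplus> r) f"
      using one_plus_frac[OF Qp(1), of r f] rf x_eq[OF QV] QV V(3) by (simp add: s_eq one_plus_apply subsetD)
    also have "\<dots> = frac Q (t \<otimes> f \<oplus> t \<otimes> r) (t \<otimes> f)"
      using rf t Qp x_eq[OF QV] by (intro frac_eqI) (auto simp: prime_mult_iff m_ac r_distr l_distr)
    finally show ?thesis
      using rf t Qp x_eq[OF QV] by (simp add: prime_mult_iff)
  qed
  ultimately have "unipotent_frac (D (h \<otimes> t)) (t \<otimes> f) (t \<otimes> r) s"
    using t rf by (simp add: unipotent_frac_def)
  then show ?thesis
    using that[of "h \<otimes> t"] h t V(3) D_mult[OF h(1) t(1)] by (auto simp: in_D)
qed

lemma F_sectionI: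
  assumes U: "openin (zariski R) U" and s: "s \<in> extensional U" and fr: "unipotent_frac U f r s"
  shows "s \<in> carrier (sections F U)"
proof -
  define x where "x = (\<lambda>P \<in> U. frac P r f)"
  have f: "f \<in> carrier R" and r: "r \<in> nilradical R" "r \<in> carrier R"
    using fr by (auto simp: unipotent_frac_def nilradical_closed)
  have prime: "primeideal P R" and fP: "f \<in> carrier R - P" and sP: "s P = frac P (f \<oplus> r) f" if "P \<in> U" for P
    using that fr openin_zariski_prime[OF U that] by (auto simp: unipotent_frac_def)
  obtain n :: nat where n: "r [^] n = \<zero>"
    using r by (auto simp: nilradical_def)
  have "\<forall>Q \<in> U. f \<notin> Q \<and> x Q = frac Q r f"
    using fP by (simp add: x_def)
  then have "\<exists>V. openin (zariski R) V \<and> P \<in> V \<and> V \<subseteq> U \<and>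
      (\<exists>r \<in> carrier R. \<exists>f \<in> carrier R. \<forall>Q \<in> V. f \<notin> Q \<and> x Q = frac Q r f)" if "P \<in> U" for P
    using U f r(2) that by blast
  then have "x \<in> carrier (structure_ring R U)"
    using frac_closed[OF prime r(2) fP] by (auto simp: structure_ring_def x_def)
  \<comment> \<open>A positive exponent exhibits the power as a product, which is extensional by
    definition of the ring.\<close>
  moreover have "x [^]\<^bsub>structure_ring R U\<^esub> Suc n = \<zero>\<^bsub>structure_ring R U\<^esub>"
  proof (rule extensionalityI[of _ U])
    show "x [^]\<^bsub>structure_ring R U\<^esub> Suc n \<in> extensional U"
      by (simp add: nat_pow_def structure_ring_def)
    show "\<zero>\<^bsub>structure_ring R U\<^esub> \<in> extensional U"
      by (simp add: structure_ring_def)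
    fix P assume P: "P \<in> U"
    have "(x [^]\<^bsub>structure_ring R U\<^esub> Suc n) P = frac P (r [^] Suc n) (f [^] Suc n)"
      using structure_ring_pow[OF P, of x "Suc n"] frac_pow[OF prime[OF P] r(2) fP[OF P], of "Suc n"] P
      by (simp add: x_def)
    also have "\<dots> = \<zero>\<^bsub>stalk R P\<^esub>"
      using frac_eq_zero_iff[OF prime[OF P], of \<zero> "f [^] Suc n"] prime_pow_notin[OF prime[OF P], of f "Suc n"]
        one_notin_prime[OF prime[OF P]] f fP[OF P] r n by (auto intro: bexI[of _ \<one>])
    finally show "(x [^]\<^bsub>structure_ring R U\<^esub> Suc n) P = \<zero>\<^bsub>structure_ring R U\<^esub> P"
      using P by (simp add: structure_ring_def)
  qed
  ultimately have x: "x \<in> nilradical (structure_ring R U)"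
    unfolding nilradical_def by blast
  have "s = \<one>\<^bsub>structure_ring R U\<^esub> \<oplus>\<^bsub>structure_ring R U\<^esub> x"
  proof (rule extensionalityI[OF s])
    show "\<one>\<^bsub>structure_ring R U\<^esub> \<oplus>\<^bsub>structure_ring R U\<^esub> x \<in> extensional U"
      by (simp add: structure_ring_def)
    show "s P = (\<one>\<^bsub>structure_ring R U\<^esub> \<oplus>\<^bsub>structure_ring R U\<^esub> x) P" if "P \<in> U" for P
      using one_plus_frac[OF prime[OF that] r(2) fP[OF that]] sP[OF that] that
      by (simp add: one_plus_apply x_def)
  qed
  then show ?thesis
    using x by (auto simp: sections_F)
qed

text \<open>The classical gluing of two fractions by a partition of unity. The new numerator is a
  combination of the old ones, hence again nilpotent.\<close>

lemma unipotent_frac_Un: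
  assumes carr: "v \<in> carrier R" "w \<in> carrier R" "h \<in> carrier R" and vw: "D h = D v \<union> D w"
    and fr: "unipotent_frac (D v) f r s" and gq: "unipotent_frac (D w) g q s"
  shows "\<exists>f r. unipotent_frac (D h) f r s"
proof -
  have f: "f \<in> carrier R" "r \<in> carrier R" "r \<in> nilradical R" and g: "g \<in> carrier R" "q \<in> carrier R" "q \<in> nilradical R"
    using fr gq by (auto simp: unipotent_frac_def nilradical_closed)
  have "D v \<subseteq> D f" "D w \<subseteq> D g"
    using fr gq by (auto simp: unipotent_frac_def in_D)
  then obtain a b :: nat and c e where c: "c \<in> carrier R" "v [^] a = c \<otimes> f" and e: "e \<in> carrier R" "w [^] b = e \<otimes> g"
    using D_subset_D carr f g by metis
  have "\<exists>t \<in> carrier R - P. t \<otimes> (r \<otimes> g \<ominus> q \<otimes> f) = \<zero>" if P: "P \<in> D (v \<otimes> w)" for P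
  proof -
    have Pp: "primeideal P R" "P \<in> D v" "P \<in> D w"
      using P carr by (auto simp: D_mult in_D)
    then have fg: "f \<notin> P" "g \<notin> P" "frac P (f \<oplus> r) f = frac P (g \<oplus> q) g"
      using fr gq by (auto simp: unipotent_frac_def)
    then obtain t where t: "t \<in> carrier R - P" "t \<otimes> ((f \<oplus> r) \<otimes> g) = t \<otimes> ((g \<oplus> q) \<otimes> f)"
      using f g frac_eq_iff[OF Pp(1), of "f \<oplus> r" f "g \<oplus> q" g] by auto
    have "t \<otimes> (r \<otimes> g \<ominus> q \<otimes> f) = t \<otimes> ((f \<oplus> r) \<otimes> g) \<ominus> t \<otimes> ((g \<oplus> q) \<otimes> f)"
      using f g t(1) by (simp, algebra)
    also have "\<dots> = \<zero>"
      using f g t by (simp add: r_neg minus_eq)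
    finally show ?thesis
      using t(1) by blast
  qed
  then obtain k :: nat where k: "(v \<otimes> w) [^] k \<otimes> (r \<otimes> g \<ominus> q \<otimes> f) = \<zero>"
    using annihilator_power[of "v \<otimes> w" "r \<otimes> g \<ominus> q \<otimes> f"] carr f g by auto
  \<comment> \<open>The power of \<open>v \<otimes> w\<close> that kills the difference is
    distributed: its \<open>v\<close> part will scale the fraction over \<open>D v\<close>, its
    \<open>w\<close> part the one over \<open>D w\<close>.\<close>
  define y z where "y = v [^] k" and "z = w [^] k"
  have yz: "y \<in> carrier R" "z \<in> carrier R"
    using carr by (auto simp: y_def z_def)
  have "y \<otimes> z \<otimes> (r \<otimes> g) = y \<otimes> z \<otimes> (q \<otimes> f)"
  proof -
    have "y \<otimes> z \<otimes> (r \<otimes> g) = y \<otimes> z \<otimes> (r \<otimes> g \<ominus> q \<otimes> f) \<oplus> y \<otimes> z \<otimes> (q \<otimes> f)"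
      using yz f g by algebra
    then show ?thesis
      using k carr yz f g by (simp add: nat_pow_distrib y_def z_def)
  qed
  \<comment> \<open>Since cf and eg are powers of \<open>v\<close> and \<open>w\<close>, the new
    denominators are powers v^(k+a) and w^(k+b). The fractions are unchanged, but their equality on
    the overlap becomes the equation \<open>r1 \<otimes> g1 = q1 \<otimes> f1\<close> in R.\<close>
  moreover define f1 r1 g1 q1 where "f1 = y \<otimes> (c \<otimes> f)" and "r1 = y \<otimes> (c \<otimes> r)"
    and "g1 = z \<otimes> (e \<otimes> g)" and "q1 = z \<otimes> (e \<otimes> q)"
  ultimately have key: "r1 \<otimes> g1 = q1 \<otimes> f1"
  proof -
    assume eq: "y \<otimes> z \<otimes> (r \<otimes> g) = y \<otimes> z \<otimes> (q \<otimes> f)"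
    have "r1 \<otimes> g1 = (c \<otimes> e) \<otimes> (y \<otimes> z \<otimes> (r \<otimes> g))"
      using yz f g c(1) e(1) by (simp add: r1_def g1_def m_ac)
    also have "\<dots> = q1 \<otimes> f1"
      unfolding eq using yz f g c(1) e(1) by (simp add: q1_def f1_def m_ac)
    finally show ?thesis .
  qed
  have carr1: "f1 \<in> carrier R" "r1 \<in> carrier R" "g1 \<in> carrier R" "q1 \<in> carrier R"
    using yz f g c e by (auto simp: f1_def r1_def g1_def q1_def)
  have f1P: "f1 \<notin> P" if "P \<in> D v" for P
    using that carr prime_pow_notin[of P v] c f by (simp add: f1_def y_def in_D prime_mult_iff flip: c(2))
  have g1P: "g1 \<notin> P" if "P \<in> D w" for P
    using that carr prime_pow_notin[of P w] e g by (simp add: g1_def z_def in_D prime_mult_iff flip: e(2))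
  have "D h \<subseteq> D f1 \<union> D g1"
    using vw f1P g1P by (auto simp: in_D)
  then obtain l :: nat and \<alpha> \<beta> where \<alpha>\<beta>: "\<alpha> \<in> carrier R" "\<beta> \<in> carrier R" "h [^] l = \<alpha> \<otimes> f1 \<oplus> \<beta> \<otimes> g1"
    by (rule D_subset_Un[OF _ carr(3) carr1(1,3)]) (rule that)
  \<comment> \<open>The weights that express \<open>H\<close> through the denominators are applied
    to the numerators, so that \<rho>/H equals both r1/f1 and q1/g1.\<close>
  define H \<rho> where "H = h [^] l" and "\<rho> = \<alpha> \<otimes> r1 \<oplus> \<beta> \<otimes> q1"
  have nil: "\<rho> \<in> nilradical R"
    unfolding \<rho>_def r1_def q1_def using \<alpha>\<beta> yz c e f g by (intro nilradical_add nilradical_mult)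
  have HR: "H \<in> carrier R" "\<rho> \<in> carrier R"
    using carr nil by (auto simp: H_def nilradical_closed)
  have HP: "H \<notin> P" if "P \<in> D h" for P
    using that carr prime_pow_notin by (auto simp: H_def in_D)
  have r1H: "r1 \<otimes> H = \<rho> \<otimes> f1"
  proof -
    have "r1 \<otimes> H = \<alpha> \<otimes> r1 \<otimes> f1 \<oplus> \<beta> \<otimes> (r1 \<otimes> g1)"
      unfolding H_def \<alpha>\<beta>(3) using \<alpha>\<beta>(1,2) carr1 by algebra
    also have "\<dots> = \<rho> \<otimes> f1"
      unfolding key \<rho>_def using \<alpha>\<beta>(1,2) carr1 by algebra
    finally show ?thesis .
  qed
  have q1H: "q1 \<otimes> H = \<rho> \<otimes> g1"
  proof -
    have "q1 \<otimes> H = \<alpha> \<otimes> (q1 \<otimes> f1) \<oplus> \<beta> \<otimes> q1 \<otimes> g1"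
      unfolding H_def \<alpha>\<beta>(3) using \<alpha>\<beta>(1,2) carr1 by algebra
    also have "\<dots> = \<rho> \<otimes> g1"
      unfolding key[symmetric] \<rho>_def using \<alpha>\<beta>(1,2) carr1 by algebra
    finally show ?thesis .
  qed
  \<comment> \<open>The last assumption equates the fraction expanded by t with \<rho>/H. It is
    applied with t = yc over \<open>D v\<close> and t = ze over \<open>D w\<close>.\<close>
  have rescale: "frac P (f' \<oplus> r') f' = frac P (H \<oplus> \<rho>) H"
    if "primeideal P R" "t \<in> carrier R" "f' \<in> carrier R" "r' \<in> carrier R"
      "t \<otimes> f' \<notin> P" "H \<notin> P" "t \<otimes> r' \<otimes> H = \<rho> \<otimes> (t \<otimes> f')" for P t f' r'
  proof -
    have tf: "t \<notin> P" "f' \<notin> P"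
      using that prime_mult_iff by auto
    have "t \<otimes> ((f' \<oplus> r') \<otimes> H) = t \<otimes> f' \<otimes> H \<oplus> t \<otimes> r' \<otimes> H"
      using that HR by algebra
    also have "\<dots> = t \<otimes> ((H \<oplus> \<rho>) \<otimes> f')"
      unfolding that(7) using that(2-4) HR by algebra
    finally show ?thesis
      using that HR tf by (subst frac_eq_iff) auto
  qed
  have "s P = frac P (H \<oplus> \<rho>) H" if P: "P \<in> D h" for P
  proof (cases "P \<in> D v")
    case True
    have "frac P (f \<oplus> r) f = frac P (H \<oplus> \<rho>) H"
      by (rule rescale[of P "y \<otimes> c"])
        (use True P HP f1P r1H f yz c(1) in \<open>auto simp: in_D f1_def r1_def m_assoc\<close>)
    then show ?thesis
      using True fr by (simp add: unipotent_frac_def)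
  next
    case False
    then have P': "P \<in> D w"
      using P vw by blast
    have "frac P (g \<oplus> q) g = frac P (H \<oplus> \<rho>) H"
      by (rule rescale[of P "z \<otimes> e"])
        (use P' P HP g1P q1H g yz e(1) in \<open>auto simp: in_D g1_def q1_def m_assoc\<close>)
    then show ?thesis
      using P' gq by (simp add: unipotent_frac_def)
  qed
  then have "unipotent_frac (D h) H \<rho> s"
    using HR HP nil by (simp add: unipotent_frac_def)
  then show ?thesis
    by blast
qed

text \<open>The unipotent version of O(D h) = R_h. Compatibility on overlaps is automatic, because
  all local fractions describe the same function \<open>s\<close>.\<close>

lemma unipotent_frac_global:
  assumes h: "h \<in> carrier R"
    and loc: "\<And>P. P \<in> D h \<Longrightarrow> \<exists>k \<in> carrier R. \<exists>f r. P \<in> D k \<and> D k \<subseteq> D h \<and> unipotent_frac (D k) f r s"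
  shows "\<exists>f r. unipotent_frac (D h) f r s"
proof (rule D_cover_induct[OF h])
  have "unipotent_frac {} \<one> \<zero> s"
    by (simp add: unipotent_frac_def nilradical_zero)
  then show "\<exists>f r. unipotent_frac {} f r s"
    by blast
next
  fix V W assume "V \<in> D ` carrier R" "W \<in> D ` carrier R" "V \<union> W \<in> D ` carrier R"
    "\<exists>f r. unipotent_frac V f r s" "\<exists>f r. unipotent_frac W f r s"
  then show "\<exists>f r. unipotent_frac (V \<union> W) f r s"
    using unipotent_frac_Un by (smt (verit) image_iff)
next
  show "\<exists>V \<in> D ` carrier R. P \<in> V \<and> V \<subseteq> D h \<and> (\<exists>f r. unipotent_frac V f r s)" if "P \<in> D h" for P
    using loc[OF that] by blast
qed (use unipotent_frac_subset in blast)

lemma F_sections_D: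
  assumes h: "h \<in> carrier R"
  shows "s \<in> carrier (sections F (D h)) \<longleftrightarrow> s \<in> extensional (D h) \<and> (\<exists>f r. unipotent_frac (D h) f r s)"
proof
  assume s: "s \<in> carrier (sections F (D h))"
  have "\<exists>k \<in> carrier R. \<exists>f r. P \<in> D k \<and> D k \<subseteq> D h \<and> unipotent_frac (D k) f r s" if "P \<in> D h" for P
    using F_local[OF openin_D[OF h] s that] by metis
  then show "s \<in> extensional (D h) \<and> (\<exists>f r. unipotent_frac (D h) f r s)"
    using F_extensional[OF s] unipotent_frac_global[OF h] by blast
next
  assume "s \<in> extensional (D h) \<and> (\<exists>f r. unipotent_frac (D h) f r s)"
  then show "s \<in> carrier (sections F (D h))"
    using F_sectionI[OF openin_D[OF h]] by blast
qed


text \<open>On \<open>D v \<inter> D w\<close> the nilpotent section \<open>r/f\<close> is a sum \<open>y + z\<close> of nilpotent sections over \<open>D v\<close> and \<open>D w\<close>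
  with numerators divisible by \<open>r\<close>. Since \<open>1 + y + z = (1 + y)(1 + z)(1 - yz/((1 + y)(1 + z)))\<close>, what remains
  has a numerator divisible by \<open>r\<^sup>2\<close>, and one concludes by induction on the order of nilpotence of \<open>r\<close>.\<close>

lemma frac_split:
  assumes carr: "v \<in> carrier R" "w \<in> carrier R" "h \<in> carrier R" and vw: "D h = D v \<union> D w"
    and "f \<in> carrier R" "r \<in> carrier R" "r [^] Suc n = \<zero>" "\<forall>P \<in> D v \<inter> D w. f \<notin> P"
  shows "\<exists>p \<in> carrier R. \<exists>q \<in> carrier R. \<exists>a \<in> nilradical R. \<exists>b \<in> nilradical R.
    (\<forall>P \<in> D v. p \<notin> P) \<and> (\<forall>P \<in> D w. q \<notin> P) \<and>
    (\<forall>P \<in> D v \<inter> D w. frac P (f \<oplus> r) f = frac P ((p \<oplus> a) \<otimes> (q \<oplus> b)) (p \<otimes> q))"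
  using assms(5-)
proof (induction n arbitrary: f r)
  case 0
  then have r: "r = \<zero>"
    by simp
  have "frac P (f \<oplus> r) f = frac P ((\<one> \<oplus> \<zero>) \<otimes> (\<one> \<oplus> \<zero>)) (\<one> \<otimes> \<one>)" if "P \<in> D v \<inter> D w" for P
    using 0 that by (intro frac_eqI) (auto simp: in_D r one_notin_prime)
  then show ?case
    using nilradical_zero by (intro bexI[of _ \<one>] bexI[of _ \<zero>]) (auto simp: in_D one_notin_prime)
next
  case (Suc n)
  have f: "f \<in> carrier R" and r: "r \<in> carrier R" and fP: "\<And>P. P \<in> D v \<inter> D w \<Longrightarrow> f \<notin> P"
    using Suc.prems by auto
  have r_nil: "r \<in> nilradical R"
    using Suc.prems unfolding nilradical_def by blast
  \<comment> \<open>The denominator is traded for a power of \<open>v \<otimes> w\<close>, which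
    factors as y times z with y invertible on \<open>D v\<close> and z on
    \<open>D w\<close>.\<close>
  have "D (v \<otimes> w) \<subseteq> D f"
    using fP carr by (auto simp: D_mult in_D)
  then obtain k :: nat and c where c: "c \<in> carrier R" "(v \<otimes> w) [^] k = c \<otimes> f"
    by (rule D_subset_D[OF _ m_closed[OF carr(1,2)] f]) (rule that)
  define y z where "y = v [^] k" and "z = w [^] k"
  have yz: "y \<in> carrier R" "z \<in> carrier R" "y \<otimes> z = c \<otimes> f"
    using carr c by (auto simp: y_def z_def nat_pow_distrib)
  have yP: "y \<notin> P" if "P \<in> D v" for P
    using that carr prime_pow_notin by (auto simp: y_def in_D)
  have zP: "z \<notin> P" if "P \<in> D w" for P
    using that carr prime_pow_notin by (auto simp: z_def in_D)
  have "D h \<subseteq> D y \<union> D z"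
    using vw yP zP by (auto simp: in_D)
  then obtain l :: nat and \<alpha> \<beta> where \<alpha>\<beta>: "\<alpha> \<in> carrier R" "\<beta> \<in> carrier R" "h [^] l = \<alpha> \<otimes> y \<oplus> \<beta> \<otimes> z"
    by (rule D_subset_Un[OF _ carr(3) yz(1,2)]) (rule that)
  define H where "H = h [^] l"
  have HP: "H \<notin> P" if "P \<in> D h" for P
    using carr that prime_pow_notin by (auto simp: H_def in_D)
  have H: "H \<in> carrier R"
    using carr by (simp add: H_def)
  \<comment> \<open>With H = \<alpha>y + \<beta>z one has r/f = rc/(yz) = rcH/(Hyz) = \<beta>cr/(Hy)
    + \<alpha>cr/(Hz), that is, r/f = a/p + b/q.\<close>
  define p q a b where "p = H \<otimes> y" and "q = H \<otimes> z" and "a = \<beta> \<otimes> c \<otimes> r" and "b = \<alpha> \<otimes> c \<otimes> r"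
  have pq: "p \<in> carrier R" "q \<in> carrier R" and ab: "a \<in> nilradical R" "b \<in> nilradical R"
    using H yz \<alpha>\<beta> c r_nil by (auto simp: p_def q_def a_def b_def nilradical_mult)
  have ab': "a \<in> carrier R" "b \<in> carrier R"
    using ab by (auto simp: nilradical_closed)
  have pP: "p \<notin> P" if "P \<in> D v" for P
    using that HP[of P] yP[OF that] vw H yz by (auto simp: p_def in_D prime_mult_iff)
  have qP: "q \<notin> P" if "P \<in> D w" for P
    using that HP[of P] zP[OF that] vw H yz by (auto simp: q_def in_D prime_mult_iff)
  \<comment> \<open>The correction factor 1 - ab/((p + a)(q + b)) is 1 + r'/f', to which the
    induction hypothesis will be applied.\<close>
  define f' r' where "f' = (p \<oplus> a) \<otimes> (q \<oplus> b)" and "r' = \<ominus> (a \<otimes> b)"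
  have f': "f' \<in> carrier R" and r': "r' \<in> carrier R"
    using pq ab' by (auto simp: f'_def r'_def)
  have f'P: "f' \<notin> P" if "P \<in> D v \<inter> D w" for P
    using that pP qP pq ab add_nil_notin ab' by (auto simp: f'_def in_D prime_mult_iff)
  have "r' = (\<ominus> (\<alpha> \<otimes> \<beta> \<otimes> c \<otimes> c)) \<otimes> (r \<otimes> r)"
    unfolding r'_def a_def b_def using \<alpha>\<beta>(1,2) c(1) r by algebra
  \<comment> \<open>Since r' is a multiple of r^2, its power n + 1 is a multiple of r^(2n+2), which
    contains r^(n+2) = 0.\<close>
  then have "r' [^] Suc n = (\<ominus> (\<alpha> \<otimes> \<beta> \<otimes> c \<otimes> c)) [^] Suc n \<otimes> (r [^] Suc n \<otimes> r [^] Suc n)"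
    using \<alpha>\<beta>(1,2) c(1) r by (simp only: nat_pow_distrib m_closed a_inv_closed)
  also have "r [^] Suc n \<otimes> r [^] Suc n = r [^] (Suc (Suc n)) \<otimes> r [^] n"
    using r by (simp add: m_ac)
  also have "\<dots> = \<zero>"
    unfolding Suc.prems(3) using r by simp
  finally have "r' [^] Suc n = \<zero>"
    using \<alpha>\<beta>(1,2) c(1) by simp
  moreover have "\<forall>P \<in> D v \<inter> D w. f' \<notin> P"
    using f'P by simp
  ultimately have IH: "\<exists>p' \<in> carrier R. \<exists>q' \<in> carrier R. \<exists>a' \<in> nilradical R. \<exists>b' \<in> nilradical R.
      (\<forall>P \<in> D v. p' \<notin> P) \<and> (\<forall>P \<in> D w. q' \<notin> P) \<and>
      (\<forall>P \<in> D v \<inter> D w. frac P (f' \<oplus> r') f' = frac P ((p' \<oplus> a') \<otimes> (q' \<oplus> b')) (p' \<otimes> q'))"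
    by (rule Suc.IH[OF f' r'])
  obtain p' q' a' b' where p': "p' \<in> carrier R" "q' \<in> carrier R"
      "a' \<in> nilradical R" "b' \<in> nilradical R" "\<forall>P \<in> D v. p' \<notin> P" "\<forall>P \<in> D w. q' \<notin> P"
    and eq': "\<forall>P \<in> D v \<inter> D w. frac P (f' \<oplus> r') f' = frac P ((p' \<oplus> a') \<otimes> (q' \<oplus> b')) (p' \<otimes> q')"
    using IH by (elim bexE conjE) (rule that)
  have ab'': "a' \<in> carrier R" "b' \<in> carrier R"
    using p' by (auto simp: nilradical_closed)
  have key: "r \<otimes> (p \<otimes> q) = (a \<otimes> q \<oplus> b \<otimes> p) \<otimes> f"
  proof -
    have "(a \<otimes> q \<oplus> b \<otimes> p) \<otimes> f = r \<otimes> H \<otimes> (c \<otimes> f) \<otimes> (\<alpha> \<otimes> y \<oplus> \<beta> \<otimes> z)"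
      unfolding a_def b_def p_def q_def using \<alpha>\<beta>(1,2) c(1) r f H yz(1,2) by algebra
    also have "\<dots> = r \<otimes> (p \<otimes> q)"
      unfolding \<alpha>\<beta>(3)[symmetric] H_def[symmetric] yz(3)[symmetric] p_def q_def
      using r H yz(1,2) by (simp add: m_ac)
    finally show ?thesis ..
  qed
  have f'r': "f' \<oplus> r' = p \<otimes> q \<oplus> (a \<otimes> q \<oplus> b \<otimes> p)"
    unfolding f'_def r'_def using pq ab' by algebra
  \<comment> \<open>Chosen so that multiplying the factors of this step by those of the induction
    hypothesis, (p + a)(p' + a') and (q + b)(q' + b'), gives denominators plus nilpotents
    again.\<close>
  define a'' b'' where "a'' = p \<otimes> a' \<oplus> a \<otimes> (p' \<oplus> a')" and "b'' = q \<otimes> b' \<oplus> b \<otimes> (q' \<oplus> b')"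
  have nil: "a'' \<in> nilradical R" "b'' \<in> nilradical R"
    unfolding a''_def b''_def using p' pq ab ab'' by (intro nilradical_add nilradical_mult; simp)+
  have prods: "p \<otimes> p' \<oplus> a'' = (p \<oplus> a) \<otimes> (p' \<oplus> a')" "q \<otimes> q' \<oplus> b'' = (q \<oplus> b) \<otimes> (q' \<oplus> b')"
    unfolding a''_def b''_def using p'(1,2) pq ab' ab'' by algebra+
  have "frac P (f \<oplus> r) f = frac P ((p \<otimes> p' \<oplus> a'') \<otimes> (q \<otimes> q' \<oplus> b'')) ((p \<otimes> p') \<otimes> (q \<otimes> q'))"
    if P: "P \<in> D v \<inter> D w" for P
  proof -
    have Pp: "primeideal P R" and notin: "f \<notin> P" "p \<notin> P" "q \<notin> P" "p' \<notin> P" "q' \<notin> P" "f' \<notin> P"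
      using P fP pP qP f'P p'(5,6) by (auto simp: in_D)
    have "(f \<oplus> r) \<otimes> (p \<otimes> q) = f \<otimes> (p \<otimes> q) \<oplus> r \<otimes> (p \<otimes> q)"
      using f r pq by algebra
    also have "\<dots> = (f' \<oplus> r') \<otimes> f"
      unfolding key f'r' using f pq ab' by algebra
    finally have "frac P (f \<oplus> r) f = frac P (f' \<oplus> r') (p \<otimes> q)"
      using f r pq f' r' notin Pp by (intro frac_eqI) (auto simp: prime_mult_iff)
    \<comment> \<open>Expanding by f' separates the already split factor f'/(pq) from the correction
      (f' + r')/f'.\<close>
    also have "\<dots> = frac P (f' \<otimes> (f' \<oplus> r')) ((p \<otimes> q) \<otimes> f')"
      using pq f' r' notin Pp by (intro frac_eqI) (auto simp: prime_mult_iff m_ac)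
    also have "\<dots> = frac P f' (p \<otimes> q) \<otimes>\<^bsub>stalk R P\<^esub> frac P (f' \<oplus> r') f'"
      using pq f' r' notin Pp by (simp add: frac_mult prime_mult_iff)
    also have "\<dots> = frac P (f' \<otimes> ((p' \<oplus> a') \<otimes> (q' \<oplus> b'))) ((p \<otimes> q) \<otimes> (p' \<otimes> q'))"
      using pq f' p'(1,2) ab'' notin Pp by (simp add: bspec[OF eq' P] frac_mult prime_mult_iff)
    also have "f' \<otimes> ((p' \<oplus> a') \<otimes> (q' \<oplus> b')) = (p \<otimes> p' \<oplus> a'') \<otimes> (q \<otimes> q' \<oplus> b'')"
      unfolding prods f'_def using pq ab' ab'' p'(1,2) by (simp add: m_ac)
    also have "(p \<otimes> q) \<otimes> (p' \<otimes> q') = (p \<otimes> p') \<otimes> (q \<otimes> q')"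
      using pq p'(1,2) by (simp add: m_ac)
    finally show ?thesis .
  qed
  moreover have "\<forall>P \<in> D v. p \<otimes> p' \<notin> P" "\<forall>P \<in> D w. q \<otimes> q' \<notin> P"
    using pP qP p' pq by (auto simp: in_D prime_mult_iff)
  ultimately show ?case
    using nil pq p'(1,2) by (meson m_closed)
qed

lemma F_mayer_vietoris:
  assumes carr: "v \<in> carrier R" "w \<in> carrier R" "h \<in> carrier R" and vw: "D h = D v \<union> D w"
    and s: "s \<in> carrier (sections F (D v \<inter> D w))"
  shows "\<exists>a \<in> carrier (sections F (D v)). \<exists>b \<in> carrier (sections F (D w)).
    s = restr F (D v) (D v \<inter> D w) a \<otimes>\<^bsub>sections F (D v \<inter> D w)\<^esub> restr F (D w) (D v \<inter> D w) b"
proof -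
  obtain f r where s_ext: "s \<in> extensional (D v \<inter> D w)" and fr: "unipotent_frac (D v \<inter> D w) f r s"
    using s F_sections_D[of "v \<otimes> w" s] carr by (auto simp: D_mult)
  then obtain n :: nat where f: "f \<in> carrier R" and r: "r \<in> carrier R" "r [^] n = \<zero>"
      and fP: "\<And>P. P \<in> D v \<inter> D w \<Longrightarrow> f \<notin> P" "\<And>P. P \<in> D v \<inter> D w \<Longrightarrow> s P = frac P (f \<oplus> r) f"
    by (auto simp: unipotent_frac_def nilradical_def)
  then have "r [^] Suc n = \<zero>" "\<forall>P \<in> D v \<inter> D w. f \<notin> P"
    by simp_all
  note split = frac_split[OF carr vw f r(1) this]
  obtain p q a b where pq: "p \<in> carrier R" "q \<in> carrier R"
    and ab: "a \<in> nilradical R" "b \<in> nilradical R"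
    and pP: "\<forall>P \<in> D v. p \<notin> P" and qP: "\<forall>P \<in> D w. q \<notin> P"
    and eq: "\<forall>P \<in> D v \<inter> D w. frac P (f \<oplus> r) f = frac P ((p \<oplus> a) \<otimes> (q \<oplus> b)) (p \<otimes> q)"
    using split by (elim bexE conjE) (rule that)
  define A B where "A = (\<lambda>P \<in> D v. frac P (p \<oplus> a) p)" and "B = (\<lambda>P \<in> D w. frac P (q \<oplus> b) q)"
  have "A \<in> carrier (sections F (D v))" "B \<in> carrier (sections F (D w))"
    using carr pq ab pP qP F_sectionI[of "D v" A p a] F_sectionI[of "D w" B q b]
    by (auto simp: A_def B_def unipotent_frac_def openin_D)
  moreover have "s = restr F (D v) (D v \<inter> D w) A \<otimes>\<^bsub>sections F (D v \<inter> D w)\<^esub> restr F (D w) (D v \<inter> D w) B"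
  proof (rule extensionalityI[OF s_ext])
    show "restr F (D v) (D v \<inter> D w) A \<otimes>\<^bsub>sections F (D v \<inter> D w)\<^esub> restr F (D w) (D v \<inter> D w) B
        \<in> extensional (D v \<inter> D w)"
      by (simp add: one_plus_N_def unipotent_units_def structure_ring_def)
    fix P assume P: "P \<in> D v \<inter> D w"
    then have "frac P ((p \<oplus> a) \<otimes> (q \<oplus> b)) (p \<otimes> q) = frac P (p \<oplus> a) p \<otimes>\<^bsub>stalk R P\<^esub> frac P (q \<oplus> b) q"
      using frac_mult[of P "p \<oplus> a" p "q \<oplus> b" q] pP qP pq ab by (simp add: in_D nilradical_closed)
    then show "s P = (restr F (D v) (D v \<inter> D w) A \<otimes>\<^bsub>sections F (D v \<inter> D w)\<^esub> restr F (D w) (D v \<inter> D w) B) P"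
      using P fP(2)[OF P] bspec[OF eq P]
      by (simp add: one_plus_N_def unipotent_units_def structure_ring_def A_def B_def)
  qed
  ultimately show ?thesis
    by blast
qed

section \<open>Restriction and gluing of unipotent sections over basic sets\<close>

lemma F_restr_closed:
  assumes U: "openin (zariski R) U" and h: "h \<in> carrier R" "D h \<subseteq> U" and s: "s \<in> carrier (sections F U)"
  shows "restr F U (D h) s \<in> carrier (sections F (D h))"
proof -
  have "\<exists>k \<in> carrier R. \<exists>f r. P \<in> D k \<and> D k \<subseteq> D h \<and> unipotent_frac (D k) f r (restrict s (D h))"
    if P: "P \<in> D h" for P
  proof -
    obtain k f r where k: "k \<in> carrier R" "P \<in> D k" "unipotent_frac (D k) f r s"
      by (rule F_local[OF U s subsetD[OF h(2) P]]) (rule that)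
    \<comment> \<open>\<open>D k\<close> need not lie in \<open>D h\<close>; multiplying by
      \<open>h\<close> cuts it down, and the local fractions are then merged by
      \<open>unipotent_frac_global\<close>.\<close>
    have "unipotent_frac (D (k \<otimes> h)) f r (restrict s (D h))"
      using unipotent_frac_cong[OF unipotent_frac_subset[OF k(3)], of "D (k \<otimes> h)" "restrict s (D h)"] k h
      by (auto simp: D_mult)
    then show ?thesis
      using P k h by (intro bexI[of _ "k \<otimes> h"] exI[of _ f] exI[of _ r]) (auto simp: D_mult)
  qed
  then have "restrict s (D h) \<in> carrier (sections F (D h))"
    using unipotent_frac_global[OF h(1)] F_sections_D[OF h(1)] by auto
  then show ?thesis
    by (simp add: one_plus_N_def)
qed

text \<open>The glued function is evident; that it is again 1 plus a nilpotent is the content of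
  \<open>unipotent_frac_Un\<close>.\<close>

lemma F_gluing:
  assumes carr: "v \<in> carrier R" "w \<in> carrier R" "h \<in> carrier R" and vw: "D h = D v \<union> D w"
    and s: "s \<in> carrier (sections F (D v))" and t: "t \<in> carrier (sections F (D w))"
    and eq: "restr F (D v) (D v \<inter> D w) s = restr F (D w) (D v \<inter> D w) t"
  shows "\<exists>c \<in> carrier (sections F (D h)). restr F (D h) (D v) c = s \<and> restr F (D h) (D w) c = t"
proof -
  define c where "c = (\<lambda>P \<in> D h. if P \<in> D v then s P else t P)"
  have cv: "s P = c P" if "P \<in> D v" for P
    using that vw by (simp add: c_def)
  have cw: "t P = c P" if "P \<in> D w" for P
    using that vw fun_cong[OF eq, of P] by (auto simp: c_def one_plus_N_def)
  obtain f r g q where fr: "unipotent_frac (D v) f r s" and gq: "unipotent_frac (D w) g q t"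
    and ext: "s \<in> extensional (D v)" "t \<in> extensional (D w)"
    using s t unfolding F_sections_D[OF carr(1)] F_sections_D[OF carr(2)] by auto
  have "\<exists>f r. unipotent_frac (D h) f r c"
    using unipotent_frac_Un[OF carr vw unipotent_frac_cong[OF fr cv] unipotent_frac_cong[OF gq cw]] by blast
  then have "c \<in> carrier (sections F (D h))"
    unfolding F_sections_D[OF carr(3)] by (simp add: c_def)
  moreover have "restrict c (D v) = s"
    by (rule extensionalityI[of _ "D v"]) (use cv ext in auto)
  moreover have "restrict c (D w) = t"
    by (rule extensionalityI[of _ "D w"]) (use cw ext in auto)
  ultimately show ?thesis
    by (auto simp: one_plus_N_def)
qed

lemma F_empty: "carrier (sections F {}) \<noteq> {}"
proof -
  \<comment> \<open>The only extensional function on the empty set takes the default value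
    everywhere.\<close>
  have "(\<lambda>P. undefined) \<in> carrier (sections F {})"
    using F_sectionI[of "{}" _ \<one> \<zero>] by (simp add: unipotent_frac_def nilradical_zero)
  then show ?thesis
    by blast
qed

lemma cohomology_one_plus_N:
  assumes "injective_resolution (zariski R) F I \<epsilon> d" "i \<ge> 1"
  shows "trivial_group (cohomology_group (zariski R) I d i)"
proof -
  interpret binary_cover_basis "zariski R" "D ` carrier R"
    by (rule basis_D)
  interpret binary_cover_resolution "zariski R" "D ` carrier R" F I \<epsilon> d
  proof
    fix V W s t assume VW: "V \<in> D ` carrier R" "W \<in> D ` carrier R" "V \<union> W \<in> D ` carrier R"
    obtain v where v: "v \<in> carrier R" "V = D v"
      using VW(1) by blast
    obtain w where w: "w \<in> carrier R" "W = D w"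
      using VW(2) by blast
    obtain h where h: "h \<in> carrier R" "V \<union> W = D h"
      using VW(3) by blast
    note eq = v(2) w(2)
    have *: "v \<in> carrier R" "w \<in> carrier R" "h \<in> carrier R" "D h = D v \<union> D w"
      using v w h by auto
    show "\<exists>c \<in> carrier (sections F (V \<union> W)). restr F (V \<union> W) V c = s \<and> restr F (V \<union> W) W c = t"
      if "s \<in> carrier (sections F V)" "t \<in> carrier (sections F W)"
        "restr F V (V \<inter> W) s = restr F W (V \<inter> W) t"
      using F_gluing[OF *, of s t] that by (simp add: eq *(4))
    show "\<exists>a \<in> carrier (sections F V). \<exists>b \<in> carrier (sections F W).
        s = restr F V (V \<inter> W) a \<otimes>\<^bsub>sections F (V \<inter> W)\<^esub> restr F W (V \<inter> W) b"
      if "s \<in> carrier (sections F (V \<inter> W))"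
      using F_mayer_vietoris[OF *, of s] that by (simp add: eq)
  qed (use assms(1) F_empty F_restr_closed in auto)
  show ?thesis
    using assms(2) by (rule trivial_cohomology)
qed

end

theorem theorem3p71:
  fixes R :: "('a, 'm) ring_scheme"
    and I :: "nat \<Rightarrow> ('a set, 'b) presheaf"
    and \<epsilon> :: "'a set set \<Rightarrow> ('a set \<Rightarrow> ('a \<times> 'a) set) \<Rightarrow> 'b"
    and d :: "nat \<Rightarrow> 'a set set \<Rightarrow> 'b \<Rightarrow> 'b"
    and i :: nat
  assumes "cring R" and "noetherian_ring R"
    and "injective_resolution (zariski R) (one_plus_N R) I \<epsilon> d"
    and "i \<ge> 1"
  shows "trivial_group (cohomology_group (zariski R) I d i)"
  using noetherian_cring.cohomology_one_plus_N[OF noetherian_cring.intro[OF assms(1,2)] assms(3,4)] .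

end
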